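(* Let $d\ge2$ and let $P_\tau$ be a probability distribution on $[0,\infty)$ not concentrated at a single point. Let $\tau_e$ have distribution $P_\tau$ and let $Y_{2d}$ be the minimum of $2d$ independent random variables with distribution $P_\tau$. Assume that $E[\tau_e]<\infty$, or that $E[Y_{2d}]<\infty$ (in which case only $K\ge3$ is considered). Let $\mu_K$ denote the time constant of first-passage percolation on the $(K,d)$-tube, and $\mu(\mathbf{e}_1)$ the time constant in direction $\mathbf{e}_1=(1,0,\dots,0)$ of first-passage percolation on the $\mathbb{Z}^d$ nearest neighbour lattice, both with i.i.d. passage times of distribution $P_\tau$. Then $$\lim_{K\to\infty}\mu_K=\mu(\mathbf{e}_1).$$
   Context: The $(K,d)$-tube is the nearest neighbour graph on $\mathbb{Z}\times\{0,1,\dots,K-1\}^{d-1}$. On each graph the edges carry i.i.d. non-negative passage times $\tau_e$ with distribution $P_\tau$. For a path $\Gamma$ (alternating sequence of vertices and edges), $T(\Gamma)=\sum_{e\in\Gamma}\tau_e$. $T_K(u,v)$, respectively $T(u,v)$, is the infimum of $T(\Gamma)$ over paths $\Gamma$ from $u$ to $v$ in the $(K,d)$-tube, respectively in $\mathbb{Z}^d$. The time constant $\mu_K\in[0,\infty)$ is the deterministic limit $\mu_K=\lim_{n\to\infty}\frac1nT_K(\mathbf{0},n\mathbf{e}_1)$, which exists in probability under the stated moment assumptions (and almost surely and in $L^1$ when $E[\tau_e]<\infty$). The time constant $\mu(\mathbf{e}_1)$ is the deterministic limit $\mu(\mathbf{e}_1)=\lim_{n\to\infty}\frac1nT(\mathbf{0},n\mathbf{e}_1)$,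 almost surely and in $L^1$. *)

theory Defs
  imports "HOL-Probability.Probability"
begin

text \<open>
  A point of the lattice of dimension \<open>d\<close> is a function \<open>nat \<Rightarrow> int\<close> whose coordinates are those
  with index \<open>0, \<dots>, d - 1\<close>; all the others are \<open>0\<close>. Coordinate \<open>0\<close> is the direction of
  \<open>\<^bold>e\<^sub>1\<close>.
\<close>

type_synonym site = "nat \<Rightarrow> int"

definition lattice_sites :: "nat \<Rightarrow> site set" where
  "lattice_sites d = {x. \<forall>i\<ge>d. x i = 0}"

definition tube_sites :: "nat \<Rightarrow> nat \<Rightarrow> site set" where
  "tube_sites d K = {x \<in> lattice_sites d. \<forall>i\<in>{1..<d}. 0 \<le> x i \<and> x i < int K}"

definition axis_site :: "nat \<Rightarrow> site" where
  "axis_site n = (\<lambda>i. if i = 0 then int n else 0)"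

definition neighbours :: "nat \<Rightarrow> site \<Rightarrow> site \<Rightarrow> bool" where
  "neighbours d x y \<longleftrightarrow> (\<Sum>i<d. \<bar>x i - y i\<bar>) = 1"

definition edges :: "nat \<Rightarrow> site set \<Rightarrow> site set set" where
  "edges d V = {{x, y} | x y. x \<in> V \<and> y \<in> V \<and> neighbours d x y}"

definition paths :: "nat \<Rightarrow> site set \<Rightarrow> site \<Rightarrow> site \<Rightarrow> site list set" where
  "paths d V u v =
     {p. p \<noteq> [] \<and> hd p = u \<and> last p = v \<and> set p \<subseteq> V \<and> successively (neighbours d) p}"

text \<open>
  Passage times are computed in \<^typ>\<open>ennreal\<close>. The coercion \<^const>\<open>ennreal\<close> would truncate
  negative edge weights to \<open>0\<close>, but it is the identity on the weights considered, which are
  almost surely non-negative.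
\<close>

definition path_time :: "(site set \<Rightarrow> real) \<Rightarrow> site list \<Rightarrow> ennreal" where
  "path_time t p = (\<Sum>(x, y)\<leftarrow>zip p (tl p). ennreal (t {x, y}))"

definition passage_time ::
  "nat \<Rightarrow> site set \<Rightarrow> (site set \<Rightarrow> real) \<Rightarrow> site \<Rightarrow> site \<Rightarrow> ennreal" where
  "passage_time d V t u v = (INF p\<in>paths d V u v. path_time t p)"

text \<open>
  The law of a family of independent edge weights with common distribution \<open>P\<close>, indexed by the
  edges of the nearest neighbour graph on \<open>V\<close>. The coordinate projections are the weights.
\<close>

definition weights :: "real measure \<Rightarrow> nat \<Rightarrow> site set \<Rightarrow> (site set \<Rightarrow> real) measure" where
  "weights P d V = (\<Pi>\<^sub>M e\<in>edges d V. P)"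

definition scaled_time :: "nat \<Rightarrow> site set \<Rightarrow> nat \<Rightarrow> (site set \<Rightarrow> real) \<Rightarrow> real" where
  "scaled_time d V n t = enn2real (passage_time d V t (axis_site 0) (axis_site n)) / real n"

definition tendsto_in_probability :: "'a measure \<Rightarrow> (nat \<Rightarrow> 'a \<Rightarrow> real) \<Rightarrow> real \<Rightarrow> bool" where
  "tendsto_in_probability M X c \<longleftrightarrow>
     (\<forall>\<epsilon>>0. (\<lambda>n. measure M {\<omega> \<in> space M. \<bar>X n \<omega> - c\<bar> > \<epsilon>}) \<longlonglongrightarrow> 0)"

definition tendsto_in_mean :: "'a measure \<Rightarrow> (nat \<Rightarrow> 'a \<Rightarrow> real) \<Rightarrow> real \<Rightarrow> bool" where
  "tendsto_in_mean M X c \<longleftrightarrow> (\<lambda>n. \<integral>\<^sup>+\<omega>. ennreal \<bar>X n \<omega> - c\<bar> \<partial>M) \<longlonglongrightarrow> 0"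

definition tube_time_constant :: "real measure \<Rightarrow> nat \<Rightarrow> nat \<Rightarrow> real" where
  "tube_time_constant P d K =
     (THE c. tendsto_in_probability (weights P d (tube_sites d K)) (scaled_time d (tube_sites d K)) c)"

text \<open>
  On the whole lattice the convergence also holds almost surely; the \<open>L\<^sup>1\<close> limit alone already
  determines the constant.
\<close>

definition lattice_time_constant :: "real measure \<Rightarrow> nat \<Rightarrow> real" where
  "lattice_time_constant P d =
     (THE c. tendsto_in_mean (weights P d (lattice_sites d)) (scaled_time d (lattice_sites d)) c)"

definition min_integrable :: "real measure \<Rightarrow> nat \<Rightarrow> bool" where
  "min_integrable P m \<longleftrightarrow>
     integrable (\<Pi>\<^sub>M i\<in>{..<m}. P) (\<lambda>\<omega>. MIN i\<in>{..<m}. \<omega> i)"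

end

theory Submission
  imports Defs "HOL-Library.Function_Algebras"
begin

text \<open>
  Write \<open>T\<^sub>V(x, y)\<close> for the passage time inside a set \<open>V\<close> of sites. Enlarging \<open>V\<close> lowers it, and on the
  whole lattice it is the infimum over cubes, because a path is finite. Running all tubes and the
  lattice on one family of lattice weights therefore makes both inequalities between the time
  constants statements about means, once every time constant is the infimum over \<open>n\<close> of
  \<open>E T\<^sub>V(u, u + n e\<^sub>1) / n\<close> (the constant \<open>speed\<close>). The lattice constant is at most each tube constant
  by monotonicity. Conversely, a block length \<open>k\<close> and a cube in which the mean time to travel \<open>k\<close>
  steps, divided by \<open>k\<close>, exceeds the lattice constant by at most \<open>\<epsilon>\<close> fit into every wide tube, so
  the tube constants are eventually at most the lattice constant plus \<open>\<epsilon>\<close>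
  (\<open>tube_time_constant_tendsto\<close>).

  That \<open>T\<^sub>V(u, u + n e\<^sub>1) / n\<close> converges in mean to this infimum \<open>\<mu>\<close>, for every \<open>V\<close> invariant along the
  axis (\<open>passage_time_converges_in_mean\<close>), needs no ergodic theorem. Since \<open>\<mu>\<close> is a lower bound of
  the means, \<open>E \<bar>Y\<bar> \<le> 2 E (max Y 0)\<close> for \<open>Y = T\<^sub>V(u, u + n e\<^sub>1) / n - \<mu>\<close>, so only an upper bound on the
  passage time matters. Concatenating translates of a nearly optimal block confined to a cube gives
  such a bound by a sum of identically distributed variables of finite range of dependence, to which
  an elementary weak law in mean applies (\<open>weak_law_in_mean\<close>).

  Two points concern integrability. The mean of \<open>T(0, e\<^sub>1)\<close> inside a small cube is finite because
  \<open>2 d\<close> edge-disjoint paths of length at most \<open>9\<close> join the two sites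
  (\<open>mean_time_edge_finite_of_min_integrable\<close>). At the corner of a tube, where the paths defining
  its time constant start, fewer edges are available and the mean may be infinite; convergence is
  therefore proved in mean at an interior site of the cross-section and transported to the corner in
  probability, at the price of a stationary error (\<open>tendsto_in_probability_change_base\<close>).
\<close>

section \<open>Passage times on a fixed configuration\<close>

lemma path_time_singleton [simp]: "path_time t [x] = 0"
  by (simp add: path_time_def)

lemma path_time_Cons_Cons [simp]:
  "path_time t (x # y # p) = ennreal (t {x, y}) + path_time t (y # p)"
  by (simp add: path_time_def)

text \<open>
  The vertex \<open>x\<close> at which the list is cut belongs to both halves, so that no edge is lost.
\<close>

lemma path_time_join:
  "path_time t (p @ x # q) = path_time t (p @ [x]) + path_time t (x # q)"
proof (induction p)
  case (Cons a p)
  then show ?case by (cases p) (auto simp: add.assoc)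
qed simp

lemma paths_join:
  assumes p: "p \<in> paths d V u v" and q: "q \<in> paths d V v w"
  shows "p @ tl q \<in> paths d V u w"
    and "path_time t (p @ tl q) = path_time t p + path_time t q"
proof -
  obtain p' where p': "p = p' @ [v]"
    using p by (auto simp: paths_def intro: append_butlast_last_id[symmetric])
  obtain q' where q': "q = v # q'"
    using q by (cases q) (auto simp: paths_def)
  show "p @ tl q \<in> paths d V u w"
    using p q unfolding p' q' paths_def
    by (auto simp: successively_append_iff hd_append split: if_splits)
  show "path_time t (p @ tl q) = path_time t p + path_time t q"
    unfolding p' q' using path_time_join[of t p' v q'] by simp
qed

lemma passage_time_le_path:
  "p \<in> paths d V u v \<Longrightarrow> passage_time d V t u v \<le> path_time t p"
  unfolding passage_time_def by (rule INF_lower)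

text \<open>
  Addition of a constant is continuous and monotone, also at \<open>\<infinity>\<close>.
\<close>

lemma INF_add_const_ennreal:
  fixes f :: "'a \<Rightarrow> ennreal"
  assumes "I \<noteq> {}"
  shows "(INF i\<in>I. f i + c) = (INF i\<in>I. f i) + c"
  using continuous_at_Inf_mono[of "\<lambda>x. x + c" "f ` I"] assms
    continuous_add[of "at_right (Inf (f ` I))" "\<lambda>x. x" "\<lambda>x. c"]
  by (auto simp: mono_def image_comp)

lemma passage_time_triangle:
  "passage_time d V t u w \<le> passage_time d V t u v + passage_time d V t v w"
proof (cases "paths d V u v = {} \<or> paths d V v w = {}")
  case True
  then show ?thesis by (auto simp: passage_time_def)
next
  case False
  have "passage_time d V t u w \<le> path_time t p + path_time t q"
    if "p \<in> paths d V u v" "q \<in> paths d V v w" for p q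
    using passage_time_le_path[OF paths_join(1)[OF that]] paths_join(2)[OF that] by metis
  then have "passage_time d V t u w
      \<le> (INF q\<in>paths d V v w. INF p\<in>paths d V u v. path_time t p + path_time t q)"
    by (intro INF_greatest)
  also have "\<dots> = (INF q\<in>paths d V v w. path_time t q + passage_time d V t u v)"
    using False unfolding passage_time_def
    by (intro INF_cong refl) (subst INF_add_const_ennreal, simp_all add: add.commute)
  also have "\<dots> = passage_time d V t u v + passage_time d V t v w"
    using False unfolding passage_time_def[of d V t v w]
    by (simp add: INF_add_const_ennreal add.commute)
  finally show ?thesis .
qed

lemma paths_mono: "V \<subseteq> W \<Longrightarrow> paths d V u v \<subseteq> paths d W u v"
  by (auto simp: paths_def)

lemma passage_time_antimono:
  "V \<subseteq> W \<Longrightarrow> passage_time d W t u v \<le> passage_time d V t u v"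
  unfolding passage_time_def by (intro INF_superset_mono paths_mono) auto

lemma path_time_finite: "path_time t p < \<infinity>"
  by (induction p rule: induct_list012) (auto simp: path_time_def)

lemma passage_time_finite: "p \<in> paths d V u v \<Longrightarrow> passage_time d V t u v < \<infinity>"
  using passage_time_le_path path_time_finite le_less_trans by metis

lemma path_time_cong:
  assumes "set p \<subseteq> V" "successively (neighbours d) p" "\<And>e. e \<in> edges d V \<Longrightarrow> s e = t e"
  shows "path_time s p = path_time t p"
  using assms(1,2)
proof (induction p rule: induct_list012)
  case (3 x y p)
  then have "{x, y} \<in> edges d V" by (auto simp: edges_def)
  with 3 assms(3) show ?case by simp
qed (auto simp: path_time_def)

lemma passage_time_cong:
  assumes "\<And>e. e \<in> edges d V \<Longrightarrow> s e = t e"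
  shows "passage_time d V s u v = passage_time d V t u v"
  unfolding passage_time_def
  by (intro INF_cong refl path_time_cong[OF _ _ assms]) (auto simp: paths_def)

lemma neighbours_translate [simp]: "neighbours d (z + x) (z + y) = neighbours d x y"
  by (simp add: neighbours_def)

lemma paths_translate:
  "paths d ((+) z ` V) (z + u) (z + v) = map ((+) z) ` paths d V u v"
proof (intro set_eqI iffI)
  fix p assume p: "p \<in> paths d ((+) z ` V) (z + u) (z + v)"
  have eq: "p = map ((+) z) (map ((+) (- z)) p)"
    by (simp add: o_def)
  have "map ((+) (- z)) p \<in> paths d V u v"
    using p neighbours_translate[of d "- z"]
    by (auto simp: paths_def hd_map last_map successively_map simp del: neighbours_translate)
  with eq show "p \<in> map ((+) z) ` paths d V u v" by blast
next
  fix p assume "p \<in> map ((+) z) ` paths d V u v"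
  then show "p \<in> paths d ((+) z ` V) (z + u) (z + v)"
    by (auto simp: paths_def hd_map last_map successively_map subset_iff)
qed

lemma path_time_translate:
  "path_time t (map ((+) z) p) = path_time (\<lambda>e. t ((+) z ` e)) p"
  by (induction p rule: induct_list012) (auto simp: path_time_def)

text \<open>
  Moving the sites is the same as moving the weights in the opposite direction. Together with the
  invariance of the law of the weights this is the source of all stationarity statements.
\<close>

lemma passage_time_translate:
  "passage_time d ((+) z ` V) t (z + u) (z + v) = passage_time d V (\<lambda>e. t ((+) z ` e)) u v"
  by (simp add: passage_time_def paths_translate image_image path_time_translate)

definition cube :: "nat \<Rightarrow> nat \<Rightarrow> site set" where
  "cube d R = {x \<in> lattice_sites d. \<forall>i<d. \<bar>x i\<bar> \<le> int R}"

lemma cube_mono: "R \<le> R' \<Longrightarrow> cube d R \<subseteq> cube d R'"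
  unfolding cube_def by force

lemma finite_set_in_cube:
  assumes "finite A" "A \<subseteq> lattice_sites d"
  obtains R where "A \<subseteq> cube d R"
proof -
  define R where "R = (\<Sum>x\<in>A. \<Sum>i<d. nat \<bar>x i\<bar>)"
  have "\<bar>x i\<bar> \<le> int R" if "x \<in> A" "i < d" for x i
  proof -
    have "nat \<bar>x i\<bar> \<le> (\<Sum>i<d. nat \<bar>x i\<bar>)"
      using that by (intro member_le_sum) auto
    also have "\<dots> \<le> R"
      unfolding R_def using that assms(1) by (intro member_le_sum[where f = "\<lambda>x. \<Sum>i<d. nat \<bar>x i\<bar>"]) auto
    finally show ?thesis by linarith
  qed
  with assms(2) have "A \<subseteq> cube d R" by (auto simp: cube_def)
  with that show ?thesis .
qed

text \<open>
  A path visits finitely many sites and hence stays in some cube.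
\<close>

lemma passage_time_INF_cube:
  assumes "V \<subseteq> lattice_sites d"
  shows "passage_time d V t u v = (INF R. passage_time d (V \<inter> cube d R) t u v)"
proof (rule antisym)
  show "passage_time d V t u v \<le> (INF R. passage_time d (V \<inter> cube d R) t u v)"
    by (intro INF_greatest passage_time_antimono) auto
  show "(INF R. passage_time d (V \<inter> cube d R) t u v) \<le> passage_time d V t u v"
    unfolding passage_time_def[of d V]
  proof (rule INF_greatest)
    fix p assume p: "p \<in> paths d V u v"
    obtain R where "set p \<subseteq> cube d R"
      using finite_set_in_cube[of "set p" d] p assms by (auto simp: paths_def)
    with p have "p \<in> paths d (V \<inter> cube d R) u v" by (auto simp: paths_def)
    then show "(INF R. passage_time d (V \<inter> cube d R) t u v) \<le> path_time t p"
      by (intro INF_lower2[of R] passage_time_le_path) auto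
  qed
qed

text \<open>
  The estimate keeps the maximum over the edges of a path visible: replacing sums by maxima is what
  later turns a minimum over paths into a minimum over single edges.
\<close>

lemma path_time_le_length_times_edge:
  assumes "length p \<ge> 2"
  obtains e where "e \<in> (\<lambda>(x, y). {x, y}) ` set (zip p (tl p))"
    and "path_time t p \<le> of_nat (length p) * ennreal (t e)"
proof -
  let ?E = "(\<lambda>(x, y). {x, y}) ` set (zip p (tl p))"
  have fin: "finite (t ` ?E)" and ne: "t ` ?E \<noteq> {}"
    using assms by (auto simp: neq_Nil_conv Suc_le_length_iff numeral_2_eq_2)
  obtain e where e: "e \<in> ?E" "t e = Max (t ` ?E)"
    using Max_in[OF fin ne] by force
  have "path_time t p \<le> (\<Sum>xy\<leftarrow>zip p (tl p). ennreal (t e))"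
    unfolding path_time_def
  proof (rule sum_list_mono)
    fix xy assume "xy \<in> set (zip p (tl p))"
    then have "t (case xy of (x, y) \<Rightarrow> {x, y}) \<le> t e"
      unfolding e(2) using fin by (intro Max_ge imageI) auto
    then show "(case xy of (x, y) \<Rightarrow> ennreal (t {x, y})) \<le> ennreal (t e)"
      by (cases xy) (auto intro: ennreal_leI)
  qed
  also have "\<dots> = of_nat (length (zip p (tl p))) * ennreal (t e)"
    by (simp only: sum_list_triv)
  also have "\<dots> \<le> of_nat (length p) * ennreal (t e)"
    by (intro mult_right_mono) auto
  finally show ?thesis using that e(1) by blast
qed

section \<open>A weak law of large numbers in mean\<close>

context prob_space
begin

text \<open>
  Only pairs at distance less than \<open>r\<close> contribute to the second moment, so it grows linearly.
\<close>

lemma second_moment_sum_le: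
  fixes W :: "nat \<Rightarrow> 'a \<Rightarrow> real"
  assumes meas [measurable]: "\<And>i. W i \<in> borel_measurable M"
    and bound: "\<And>i \<omega>. \<bar>W i \<omega>\<bar> \<le> C"
    and mean: "\<And>i. expectation (W i) = 0"
    and indep: "\<And>i j. i + r \<le> j \<Longrightarrow> indep_var borel (W i) borel (W j)"
  shows "expectation (\<lambda>\<omega>. (\<Sum>i<n. W i \<omega>)\<^sup>2) \<le> 2 * real r * real n * C\<^sup>2"
proof -
  have int: "integrable M (W i)" for i
    using bound by (intro integrable_const_bound[of _ C]) auto
  have prod_bound: "\<bar>W i \<omega> * W j \<omega>\<bar> \<le> C\<^sup>2" for i j \<omega>
    unfolding abs_mult power2_eq_square
    using bound[of i \<omega>] bound[of j \<omega>] by (intro mult_mono) auto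
  have int2: "integrable M (\<lambda>\<omega>. W i \<omega> * W j \<omega>)" for i j
    using prod_bound by (intro integrable_const_bound[of _ "C\<^sup>2"]) auto
  have far: "expectation (\<lambda>\<omega>. W i \<omega> * W j \<omega>) = 0" if "i + r \<le> j \<or> j + r \<le> i" for i j
    using that
  proof
    assume "i + r \<le> j"
    from indep_var_lebesgue_integral[OF indep[OF this] int int] show ?thesis
      by (simp add: mean)
  next
    assume "j + r \<le> i"
    from indep_var_lebesgue_integral[OF indep[OF this] int int] show ?thesis
      by (simp add: mean mult.commute)
  qed
  have near: "expectation (\<lambda>\<omega>. W i \<omega> * W j \<omega>) \<le> C\<^sup>2" for i j
  proof -
    have "expectation (\<lambda>\<omega>. W i \<omega> * W j \<omega>) \<le> expectation (\<lambda>\<omega>. C\<^sup>2)"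
      using prod_bound[of i _ j] int2 by (intro integral_mono) (auto simp: abs_le_iff)
    then show ?thesis by (simp add: prob_space)
  qed
  have row: "(\<Sum>j<n. expectation (\<lambda>\<omega>. W i \<omega> * W j \<omega>)) \<le> 2 * real r * C\<^sup>2" for i
  proof -
    let ?N = "{j\<in>{..<n}. j < i + r \<and> i < j + r}"
    have "card ?N \<le> card {i + 1 - r..<i + r}"
      by (rule card_mono) auto
    then have card: "card ?N \<le> 2 * r" by simp
    have "(\<Sum>j<n. expectation (\<lambda>\<omega>. W i \<omega> * W j \<omega>)) = (\<Sum>j\<in>?N. expectation (\<lambda>\<omega>. W i \<omega> * W j \<omega>))"
      by (rule sum.mono_neutral_right) (auto intro!: far)
    also have "\<dots> \<le> real (card ?N) * C\<^sup>2"
      using sum_mono[of ?N "\<lambda>j. expectation (\<lambda>\<omega>. W i \<omega> * W j \<omega>)" "\<lambda>_. C\<^sup>2"] near by simp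
    also have "\<dots> \<le> 2 * real r * C\<^sup>2"
      using card by (intro mult_right_mono) auto
    finally show ?thesis .
  qed
  have "expectation (\<lambda>\<omega>. (\<Sum>i<n. W i \<omega>)\<^sup>2) = (\<Sum>i<n. \<Sum>j<n. expectation (\<lambda>\<omega>. W i \<omega> * W j \<omega>))"
    by (simp add: power2_eq_square sum_product int2)
  also have "\<dots> \<le> (\<Sum>i<n. 2 * real r * C\<^sup>2)"
    by (intro sum_mono row)
  finally show ?thesis by (simp add: mult_ac)
qed

lemma truncation_tendsto:
  fixes X :: "'a \<Rightarrow> real"
  assumes int: "integrable M X"
  shows "(\<lambda>N. expectation (\<lambda>\<omega>. min (X \<omega>) (real N))) \<longlonglongrightarrow> expectation X"
proof (rule integral_dominated_convergence[where w = "\<lambda>\<omega>. \<bar>X \<omega>\<bar>"])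
  note [measurable] = borel_measurable_integrable[OF int]
  show "X \<in> borel_measurable M" "(\<lambda>\<omega>. min (X \<omega>) (real N)) \<in> borel_measurable M" for N
    by measurable
  show "AE \<omega> in M. (\<lambda>N. min (X \<omega>) (real N)) \<longlonglongrightarrow> X \<omega>"
  proof (intro AE_I2 tendsto_eventually)
    fix \<omega>
    show "\<forall>\<^sub>F N in sequentially. min (X \<omega>) (real N) = X \<omega>"
      using filterlim_real_sequentially unfolding filterlim_at_top
      by (auto elim!: allE[of _ "X \<omega>"] eventually_mono)
  qed
qed (use int in auto)

text \<open>
  The moment bound is applied to the variables truncated at a level \<open>N\<close>; what truncation cuts off has
  small mean, uniformly in \<open>i\<close> because the laws agree. Pairs need to be independent only at
  distance \<open>r\<close>: blocks of edges read by consecutive pieces of a path overlap.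
\<close>

lemma weak_law_in_mean:
  fixes X :: "nat \<Rightarrow> 'a \<Rightarrow> real"
  assumes int: "\<And>i. integrable M (X i)"
    and nonneg: "\<And>i \<omega>. 0 \<le> X i \<omega>"
    and ident: "\<And>i. distr M borel (X i) = distr M borel (X 0)"
    and indep: "\<And>i j. i + r \<le> j \<Longrightarrow> indep_var borel (X i) borel (X j)"
  shows "(\<lambda>n. expectation (\<lambda>\<omega>. \<bar>(\<Sum>i<n. X i \<omega>) - real n * expectation (X 0)\<bar>) / real n) \<longlonglongrightarrow> 0"
proof (rule LIMSEQ_I)
  note [measurable] = borel_measurable_integrable[OF int]
  define b where "b = expectation (X 0)"
  define m where "m N = expectation (\<lambda>\<omega>. min (X 0 \<omega>) (real N))" for N :: nat
  fix \<epsilon> :: real assume \<epsilon>: "0 < \<epsilon>"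
  have "m \<longlonglongrightarrow> b"
    unfolding m_def b_def using truncation_tendsto[OF int] by simp
  then have "\<forall>\<^sub>F N in sequentially. \<bar>m N - b\<bar> < \<epsilon> / 8"
    using tendstoD[of m b sequentially "\<epsilon> / 8"] \<epsilon> by (simp add: dist_real_def)
  then obtain N where N: "\<bar>m N - b\<bar> < \<epsilon> / 8"
    using eventually_happens'[OF sequentially_bot] by blast
  define Y where "Y i \<omega> = min (X i \<omega>) (real N)" for i \<omega>
  have Y_meas [measurable]: "Y i \<in> borel_measurable M" for i
    unfolding Y_def[abs_def] by measurable
  have Y_bound: "0 \<le> Y i \<omega>" "Y i \<omega> \<le> real N" for i \<omega>
    using nonneg by (auto simp: Y_def)
  have Y_int: "integrable M (Y i)" for i
    using Y_bound by (intro integrable_const_bound[of _ "real N"]) auto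
  have transfer: "expectation (\<lambda>\<omega>. f (X i \<omega>)) = expectation (\<lambda>\<omega>. f (X 0 \<omega>))"
    if "f \<in> borel_measurable borel" for f :: "real \<Rightarrow> real" and i
    using integral_distr[of "X i" M borel f] integral_distr[of "X 0" M borel f] ident[of i] that
    by simp
  have EY: "expectation (Y i) = m N" for i
    using transfer[of "\<lambda>x. min x (real N)" i] by (simp add: m_def Y_def[abs_def])
  have EX: "expectation (X i) = b" for i
    using transfer[of "\<lambda>x. x" i] by (simp add: b_def)
  have m_bound: "0 \<le> m N" "m N \<le> real N"
  proof -
    show "0 \<le> m N"
      unfolding m_def using nonneg by (intro integral_nonneg_AE) auto
    have "expectation (Y 0) \<le> expectation (\<lambda>_. real N)"
      using Y_bound Y_int by (intro integral_mono) auto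
    then show "m N \<le> real N" by (simp add: EY prob_space)
  qed
  define W where "W i \<omega> = Y i \<omega> - m N" for i \<omega>
  have W_meas [measurable]: "W i \<in> borel_measurable M" for i
    unfolding W_def[abs_def] by measurable
  have W_bound: "\<bar>W i \<omega>\<bar> \<le> real N" for i \<omega>
    using Y_bound[of i \<omega>] m_bound by (auto simp: W_def)
  have W_mean: "expectation (W i) = 0" for i
    unfolding W_def[abs_def] using Y_int by (simp add: EY prob_space)
  have W_indep: "indep_var borel (W i) borel (W j)" if "i + r \<le> j" for i j
    using indep_var_compose[OF indep[OF that], of "\<lambda>x. min x (real N) - m N" borel
        "\<lambda>x. min x (real N) - m N" borel]
    by (simp add: W_def[abs_def] Y_def o_def)
  define S where "S n \<omega> = (\<Sum>i<n. W i \<omega>)" for n \<omega>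
  have S_meas [measurable]: "S n \<in> borel_measurable M" for n
    unfolding S_def[abs_def] by measurable
  have S_bound: "\<bar>S n \<omega>\<bar> \<le> real n * real N" for n \<omega>
  proof -
    have "\<bar>S n \<omega>\<bar> \<le> (\<Sum>i<n. \<bar>W i \<omega>\<bar>)" unfolding S_def by (rule sum_abs)
    also have "\<dots> \<le> (\<Sum>i<n. real N)" by (intro sum_mono W_bound)
    finally show ?thesis by simp
  qed
  have S_int: "integrable M (S n)" for n
    using S_bound by (intro integrable_const_bound[of _ "real n * real N"]) auto
  have S2_int: "integrable M (\<lambda>\<omega>. (S n \<omega>)\<^sup>2)" for n
  proof (intro integrable_const_bound[of _ "(real n * real N)\<^sup>2"] AE_I2)
    show "norm ((S n \<omega>)\<^sup>2) \<le> (real n * real N)\<^sup>2" for \<omega>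
      using power_mono[OF S_bound[of n \<omega>], of 2] by simp
  qed measurable
  define D where "D = 2 * real r * (real N)\<^sup>2"
  have ES2: "expectation (\<lambda>\<omega>. (S n \<omega>)\<^sup>2) \<le> D * real n" for n
    using second_moment_sum_le[where W = W and C = "real N" and r = r and n = n] W_meas W_bound W_mean W_indep
    by (simp add: S_def D_def mult_ac)
  define \<delta> where "\<delta> = \<epsilon> / 4"
  have \<delta>: "\<delta> > 0" using \<epsilon> by (simp add: \<delta>_def)
  \<comment> \<open>The elementary bound \<open>\<bar>s\<bar> \<le> \<delta> n + s\<^sup>2 / (\<delta> n)\<close> replaces the Cauchy--Schwarz inequality.\<close>
  have ES: "expectation (\<lambda>\<omega>. \<bar>S n \<omega>\<bar>) \<le> \<delta> * real n + D / \<delta>" if n: "n > 0" for n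
  proof -
    have "\<bar>s\<bar> \<le> \<delta> * real n + s\<^sup>2 / (\<delta> * real n)" for s :: real
    proof (cases "\<bar>s\<bar> \<le> \<delta> * real n")
      case True
      then show ?thesis using \<delta> n by (simp add: add_increasing2)
    next
      case False
      then have "\<bar>s\<bar> * (\<delta> * real n) \<le> s\<^sup>2"
        using mult_left_mono[of "\<delta> * real n" "\<bar>s\<bar>" "\<bar>s\<bar>"] by (simp add: power2_eq_square)
      then have "\<bar>s\<bar> \<le> s\<^sup>2 / (\<delta> * real n)"
        using \<delta> n by (subst pos_le_divide_eq) auto
      then show ?thesis using \<delta> by (simp add: add_increasing)
    qed
    then have "expectation (\<lambda>\<omega>. \<bar>S n \<omega>\<bar>) \<le> expectation (\<lambda>\<omega>. \<delta> * real n + (S n \<omega>)\<^sup>2 / (\<delta> * real n))"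
      using S_int S2_int by (intro integral_mono) auto
    also have "\<dots> = \<delta> * real n + expectation (\<lambda>\<omega>. (S n \<omega>)\<^sup>2) / (\<delta> * real n)"
      using S2_int by (simp add: prob_space)
    also have "\<dots> \<le> \<delta> * real n + (D * real n) / (\<delta> * real n)"
      using ES2 \<delta> n by (intro add_left_mono divide_right_mono) auto
    also have "\<dots> = \<delta> * real n + D / \<delta>" using n by simp
    finally show ?thesis .
  qed
  have dev: "expectation (\<lambda>\<omega>. \<bar>(\<Sum>i<n. X i \<omega>) - real n * b\<bar>)
      \<le> expectation (\<lambda>\<omega>. \<bar>S n \<omega>\<bar>) + 2 * real n * \<bar>m N - b\<bar>" for n
  proof -
    have "\<bar>(\<Sum>i<n. X i \<omega>) - real n * b\<bar>
        \<le> \<bar>S n \<omega>\<bar> + (\<Sum>i<n. X i \<omega> - Y i \<omega>) + real n * \<bar>m N - b\<bar>" for \<omega>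
    proof -
      have "(\<Sum>i<n. X i \<omega>) - real n * b
          = S n \<omega> + (\<Sum>i<n. X i \<omega> - Y i \<omega>) + real n * (m N - b)"
        by (simp add: S_def W_def sum_subtractf algebra_simps)
      moreover have "0 \<le> (\<Sum>i<n. X i \<omega> - Y i \<omega>)"
        by (intro sum_nonneg) (simp add: Y_def)
      moreover have "\<bar>real n * (m N - b)\<bar> = real n * \<bar>m N - b\<bar>"
        by (simp add: abs_mult)
      ultimately show ?thesis by linarith
    qed
    then have "expectation (\<lambda>\<omega>. \<bar>(\<Sum>i<n. X i \<omega>) - real n * b\<bar>)
        \<le> expectation (\<lambda>\<omega>. \<bar>S n \<omega>\<bar> + (\<Sum>i<n. X i \<omega> - Y i \<omega>) + real n * \<bar>m N - b\<bar>)"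
      using S_int int Y_int by (intro integral_mono) auto
    also have "\<dots> = expectation (\<lambda>\<omega>. \<bar>S n \<omega>\<bar>) + real n * (b - m N) + real n * \<bar>m N - b\<bar>"
      using S_int int Y_int by (simp add: EX EY prob_space)
    also have "\<dots> \<le> expectation (\<lambda>\<omega>. \<bar>S n \<omega>\<bar>) + 2 * real n * \<bar>m N - b\<bar>"
      using mult_left_mono[of "b - m N" "\<bar>m N - b\<bar>" "real n"] by simp
    finally show ?thesis .
  qed
  obtain n0 where n0: "D / (\<delta> * (\<epsilon> / 4)) < real n0" using reals_Archimedean2 by blast
  show "\<exists>n0. \<forall>n\<ge>n0. norm (expectation (\<lambda>\<omega>. \<bar>(\<Sum>i<n. X i \<omega>) - real n * expectation (X 0)\<bar>) / real n - 0) < \<epsilon>"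
  proof (intro exI[of _ "Suc n0"] allI impI)
    fix n assume n: "n \<ge> Suc n0"
    then have n_pos: "n > 0" and "D / (\<delta> * (\<epsilon> / 4)) < real n" using n0 by auto
    then have "D / \<delta> < \<epsilon> / 4 * real n"
      using \<delta> \<epsilon> by (simp add: field_simps)
    moreover have "2 * real n * \<bar>m N - b\<bar> \<le> \<epsilon> / 4 * real n"
      using N n_pos by (simp add: field_simps)
    ultimately have "expectation (\<lambda>\<omega>. \<bar>(\<Sum>i<n. X i \<omega>) - real n * b\<bar>)
        < \<delta> * real n + \<epsilon> / 4 * real n + \<epsilon> / 4 * real n"
      using dev[of n] ES[OF n_pos] by linarith
    also have "\<dots> \<le> \<epsilon> * real n" using \<epsilon> by (simp add: \<delta>_def field_simps)
    finally have "expectation (\<lambda>\<omega>. \<bar>(\<Sum>i<n. X i \<omega>) - real n * b\<bar>) / real n < \<epsilon>"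
      using n_pos by (simp add: field_simps)
    moreover have "0 \<le> expectation (\<lambda>\<omega>. \<bar>(\<Sum>i<n. X i \<omega>) - real n * b\<bar>) / real n"
      by (intro divide_nonneg_nonneg integral_nonneg_AE) auto
    ultimately show "norm (expectation (\<lambda>\<omega>. \<bar>(\<Sum>i<n. X i \<omega>) - real n * expectation (X 0)\<bar>) / real n - 0) < \<epsilon>"
      by (simp add: b_def)
  qed
qed

end

section \<open>Random weights on the lattice\<close>

lemma edges_mono: "V \<subseteq> W \<Longrightarrow> edges d V \<subseteq> edges d W"
  unfolding edges_def by blast

lemma edgesI: "x \<in> V \<Longrightarrow> y \<in> V \<Longrightarrow> neighbours d x y \<Longrightarrow> {x, y} \<in> edges d V"
  unfolding edges_def by blast

lemma axis_site_0 [simp]: "axis_site 0 = 0"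
  by (simp add: axis_site_def fun_eq_iff)

lemma axis_site_add: "axis_site (m + n) = axis_site m + axis_site n"
  by (simp add: axis_site_def fun_eq_iff)

lemma lattice_sites_add [intro, simp]:
  "x \<in> lattice_sites d \<Longrightarrow> y \<in> lattice_sites d \<Longrightarrow> x + y \<in> lattice_sites d"
  by (simp add: lattice_sites_def)

lemma axis_site_in_lattice [intro, simp]: "0 < d \<Longrightarrow> axis_site n \<in> lattice_sites d"
  by (simp add: lattice_sites_def axis_site_def)

lemma countable_lattice_sites: "countable (lattice_sites d)"
proof -
  have "countable ((\<lambda>x. restrict x {..<d}) ` lattice_sites d)"
  proof (rule countable_subset)
    show "countable (PiE {..<d} (\<lambda>_. UNIV :: int set))" by (rule countable_PiE) auto
  qed (auto split: if_splits)
  moreover have "inj_on (\<lambda>x. restrict x {..<d}) (lattice_sites d)"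
  proof (rule inj_onI)
    fix x y assume xy: "x \<in> lattice_sites d" "y \<in> lattice_sites d"
      and eq: "restrict x {..<d} = restrict y {..<d}"
    show "x = y"
    proof
      fix i show "x i = y i"
        using xy fun_cong[OF eq, of i] by (cases "i < d") (auto simp: lattice_sites_def)
    qed
  qed
  ultimately show ?thesis by (rule countable_image_inj_on)
qed

lemma countable_paths: "V \<subseteq> lattice_sites d \<Longrightarrow> countable (paths d V u v)"
  by (rule countable_subset[OF _ countable_lists[OF countable_lattice_sites[of d]]]) (auto simp: paths_def)

lemma neighbours_axis [simp]: "0 < d \<Longrightarrow> neighbours d u (axis_site 1 + u)"
  by (simp add: neighbours_def axis_site_def if_distrib[of abs] cong: if_cong)

lemma integral_enn2real:
  fixes f :: "'a \<Rightarrow> ennreal"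
  assumes [measurable]: "f \<in> borel_measurable M" and fin: "\<And>x. f x < \<infinity>" and int: "(\<integral>\<^sup>+x. f x \<partial>M) < \<infinity>"
  shows "integrable M (\<lambda>x. enn2real (f x))"
    and "(\<integral>x. enn2real (f x) \<partial>M) = enn2real (\<integral>\<^sup>+x. f x \<partial>M)"
proof -
  have "ennreal (enn2real (f x)) = f x" for x
    using fin[of x] by simp
  then show "integrable M (\<lambda>x. enn2real (f x))"
    and "(\<integral>x. enn2real (f x) \<partial>M) = enn2real (\<integral>\<^sup>+x. f x \<partial>M)"
    using int by (auto intro!: integrableI_bounded simp: integral_eq_nn_integral)
qed

locale percolation = P: prob_space P for P :: "real measure" +
  fixes d :: nat
  assumes sets_P: "sets P = sets borel" and dim: "2 \<le> d"
begin

abbreviation "L \<equiv> lattice_sites d"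

abbreviation "M \<equiv> weights P d L"

lemma dim_pos [simp]: "0 < d" using dim by simp

lemma prob_space_M: "prob_space M"
  unfolding weights_def by (intro prob_space_PiM) unfold_locales

sublocale M: prob_space M by (rule prob_space_M)

lemma edges_ne: "edges d L \<noteq> {}"
proof -
  have "{0, axis_site 1 + 0} \<in> edges d L"
    by (intro edgesI neighbours_axis) (auto simp: lattice_sites_def axis_site_def)
  then show ?thesis by blast
qed

lemma weight_measurable:
  "e \<in> E \<Longrightarrow> (\<lambda>t. t e) \<in> borel_measurable (\<Pi>\<^sub>M e\<in>E. P)"
  using measurable_component_singleton[of e E "\<lambda>_. P"] measurable_cong_sets[OF refl sets_P] by blast

lemma path_time_measurable:
  assumes "set p \<subseteq> V" "successively (neighbours d) p" "edges d V \<subseteq> E"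
  shows "(\<lambda>t. path_time t p) \<in> borel_measurable (\<Pi>\<^sub>M e\<in>E. P)"
  using assms(1,2)
proof (induction p rule: induct_list012)
  case (3 x y p)
  then have "{x, y} \<in> E" using assms(3) by (auto simp: edges_def)
  then have [measurable]: "(\<lambda>t. t {x, y}) \<in> borel_measurable (\<Pi>\<^sub>M e\<in>E. P)"
    by (rule weight_measurable)
  have [measurable]: "(\<lambda>t. path_time t (y # p)) \<in> borel_measurable (\<Pi>\<^sub>M e\<in>E. P)"
    using 3 by auto
  show ?case unfolding path_time_Cons_Cons by measurable
qed (auto simp: path_time_def)

lemma passage_time_measurable:
  assumes "V \<subseteq> L" "edges d V \<subseteq> E"
  shows "(\<lambda>t. passage_time d V t u v) \<in> borel_measurable (\<Pi>\<^sub>M e\<in>E. P)"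
  unfolding passage_time_def
  by (intro borel_measurable_INF countable_paths assms path_time_measurable[OF _ _ assms(2)])
     (auto simp: paths_def)

lemma passage_time_measurable_M [measurable]:
  "V \<subseteq> L \<Longrightarrow> (\<lambda>t. passage_time d V t u v) \<in> borel_measurable M"
  unfolding weights_def by (intro passage_time_measurable edges_mono)

text \<open>
  This is the coupling of all tubes with the lattice.
\<close>

lemma restrict_weights:
  assumes "V \<subseteq> L"
  shows "distr M (weights P d V) (\<lambda>t. restrict t (edges d V)) = weights P d V"
  using distr_PiM_reindex[of "edges d L" "\<lambda>_. P" "\<lambda>e. e" "edges d V"] edges_mono[OF assms]
    P.prob_space_axioms by (auto simp: weights_def restrict_def)

definition translate_weights :: "site \<Rightarrow> (site set \<Rightarrow> real) \<Rightarrow> site set \<Rightarrow> real" where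
  "translate_weights z t = (\<lambda>e\<in>edges d L. t ((+) z ` e))"

lemma translate_edge:
  assumes "z \<in> L" "e \<in> edges d L" shows "(+) z ` e \<in> edges d L"
proof -
  from assms(2) obtain x y where "e = {x, y}" "x \<in> L" "y \<in> L" "neighbours d x y"
    by (auto simp: edges_def)
  with assms(1) show ?thesis
    by (auto intro!: edgesI)
qed

lemma distr_translate_weights:
  assumes "z \<in> L"
  shows "distr M M (translate_weights z) = M"
    and "translate_weights z \<in> measurable M M"
proof -
  have inj: "inj_on ((`) ((+) z)) (edges d L)"
    by (intro inj_onI) (simp add: inj_image_eq_iff)
  have maps: "(`) ((+) z) \<in> edges d L \<rightarrow> edges d L"
    using translate_edge[OF assms] by blast
  show "distr M M (translate_weights z) = M"
    using distr_PiM_reindex[of "edges d L" "\<lambda>_. P", OF P.prob_space_axioms inj maps]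
    by (simp add: weights_def translate_weights_def[abs_def])
  show "translate_weights z \<in> measurable M M"
    unfolding weights_def translate_weights_def[abs_def]
    by (rule measurable_restrict) (rule measurable_component_singleton[OF translate_edge[OF assms]])
qed

lemma passage_time_translate_weights:
  assumes "V \<subseteq> L"
  shows "passage_time d V (translate_weights z t) u v = passage_time d ((+) z ` V) t (z + u) (z + v)"
  unfolding passage_time_translate
  by (rule passage_time_cong) (use edges_mono[OF assms] in \<open>auto simp: translate_weights_def\<close>)

text \<open>
  Here \<open>f\<close> leaves open whether the passage time is read as an extended or, after \<^const>\<open>enn2real\<close>, as a
  real number.
\<close>

lemma distr_passage_time_translate:
  assumes "V \<subseteq> L" "z \<in> L" and f [measurable]: "f \<in> measurable borel N"
  shows "distr M N (\<lambda>t. f (passage_time d ((+) z ` V) t (z + u) (z + v)))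
       = distr M N (\<lambda>t. f (passage_time d V t u v))"
proof -
  note [measurable] = distr_translate_weights(2)[OF assms(2)] passage_time_measurable_M[OF assms(1)]
  have "distr M N (\<lambda>t. f (passage_time d V t u v))
      = distr (distr M M (translate_weights z)) N (\<lambda>t. f (passage_time d V t u v))"
    by (simp add: distr_translate_weights[OF assms(2)])
  also have "\<dots> = distr M N (\<lambda>t. f (passage_time d V (translate_weights z t) u v))"
    by (subst distr_distr) (auto simp: o_def)
  finally show ?thesis by (simp add: passage_time_translate_weights[OF assms(1)])
qed

lemma translate_subset_lattice: "V \<subseteq> L \<Longrightarrow> z \<in> L \<Longrightarrow> (+) z ` V \<subseteq> L"
  by auto

definition mean_time :: "site set \<Rightarrow> site \<Rightarrow> site \<Rightarrow> ennreal" where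
  "mean_time V u v = (\<integral>\<^sup>+t. passage_time d V t u v \<partial>M)"

lemma mean_time_translate:
  assumes "V \<subseteq> L" "z \<in> L"
  shows "mean_time ((+) z ` V) (z + u) (z + v) = mean_time V u v"
  using distr_passage_time_translate[OF assms, of "\<lambda>x. x" borel u v]
    nn_integral_distr[of "\<lambda>t. passage_time d V t u v" M borel "\<lambda>x. x"]
    nn_integral_distr[of "\<lambda>t. passage_time d ((+) z ` V) t (z + u) (z + v)" M borel "\<lambda>x. x"]
    passage_time_measurable_M[OF assms(1)]
    passage_time_measurable_M[OF translate_subset_lattice[OF assms]]
  by (simp add: mean_time_def)

lemma mean_time_triangle:
  assumes "V \<subseteq> L"
  shows "mean_time V u w \<le> mean_time V u v + mean_time V v w"
  unfolding mean_time_def using assms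
  by (subst nn_integral_add[symmetric]) (auto intro!: nn_integral_mono passage_time_triangle)

lemma mean_time_antimono: "V \<subseteq> W \<Longrightarrow> mean_time W u v \<le> mean_time V u v"
  unfolding mean_time_def by (intro nn_integral_mono passage_time_antimono)

text \<open>
  A passage time inside \<open>V\<close> reads only the weights of the edges of \<open>V\<close>, and the weights of two
  disjoint sets of edges are independent.
\<close>

lemma indep_passage_times:
  assumes "V \<subseteq> L" "W \<subseteq> L" and disj: "edges d V \<inter> edges d W = {}"
  shows "M.indep_var borel (\<lambda>t. enn2real (passage_time d V t u v))
                     borel (\<lambda>t. enn2real (passage_time d W t u' v'))"
proof -
  have coord: "M.indep_vars (\<lambda>_. P) (\<lambda>e t. t e) (edges d L)"
  proof (subst M.indep_vars_iff_distr_eq_PiM'[OF edges_ne])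
    show "M.random_variable P (\<lambda>t. t e)" if "e \<in> edges d L" for e
      using that by (simp add: weights_def)
    have "distr M (Pi\<^sub>M (edges d L) (\<lambda>_. P)) (\<lambda>x. \<lambda>i\<in>edges d L. x i) = M"
      using distr_PiM_reindex[of "edges d L" "\<lambda>_. P" "\<lambda>e. e" "edges d L"] P.prob_space_axioms
      by (simp add: weights_def)
    also have "\<dots> = Pi\<^sub>M (edges d L) (\<lambda>i. distr M P (\<lambda>t. t i))"
      unfolding weights_def
      by (intro PiM_cong refl distr_PiM_component[symmetric]) (use P.prob_space_axioms in auto)
    finally show "distr M (Pi\<^sub>M (edges d L) (\<lambda>_. P)) (\<lambda>x. \<lambda>i\<in>edges d L. x i)
        = Pi\<^sub>M (edges d L) (\<lambda>i. distr M P (\<lambda>t. t i))" .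
  qed
  have restr: "(\<lambda>t. enn2real (passage_time d U (restrict t (edges d U)) x y))
      = (\<lambda>t. enn2real (passage_time d U t x y))" for U x y
    by (rule ext, rule arg_cong[where f = enn2real], rule passage_time_cong) simp
  have meas: "(\<lambda>t. enn2real (passage_time d U t x y)) \<in> borel_measurable (Pi\<^sub>M (edges d U) (\<lambda>_. P))"
    if "U \<subseteq> L" for U x y
    using passage_time_measurable[OF that order_refl] by measurable
  have "M.indep_var (Pi\<^sub>M (edges d V) (\<lambda>_. P)) (\<lambda>t. restrict t (edges d V))
                    (Pi\<^sub>M (edges d W) (\<lambda>_. P)) (\<lambda>t. restrict t (edges d W))"
    using M.indep_var_restrict[OF coord disj edges_mono[OF assms(1)] edges_mono[OF assms(2)]] by simp
  from M.indep_var_compose[OF this meas[OF assms(1), of u v] meas[OF assms(2), of u' v']]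
  show ?thesis by (simp add: o_def restr)
qed

end

section \<open>Convergence in mean along the axis\<close>

definition axis_invariant :: "nat \<Rightarrow> site set \<Rightarrow> bool" where
  "axis_invariant d V \<longleftrightarrow> V \<subseteq> lattice_sites d \<and> (\<forall>n. (+) (axis_site n) ` V = V)"

lemma axis_invariantD:
  assumes "axis_invariant d V"
  shows "V \<subseteq> lattice_sites d" "(+) (axis_site n) ` V = V" "x \<in> V \<Longrightarrow> axis_site n + x \<in> V"
  using assms by (auto simp: axis_invariant_def)

lemma cube_translate:
  assumes "0 < d" "V \<subseteq> lattice_sites d"
  shows "(+) (axis_site n) ` (V \<inter> cube d R) \<subseteq> (+) (axis_site n) ` V \<inter> cube d (R + n)"
proof -
  have "axis_site n + x \<in> cube d (R + n)" if "x \<in> cube d R" for x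
    using that assms(1) by (fastforce simp: cube_def axis_site_def lattice_sites_def)
  then show ?thesis by blast
qed

text \<open>
  A subset of a cube of radius \<open>R\<close> spans at most \<open>2 R\<close> steps along the axis.
\<close>

lemma edges_translates_disjoint:
  assumes "0 < d" "V \<subseteq> cube d R" "m + 2 * R < n"
  shows "edges d ((+) (axis_site m) ` V) \<inter> edges d ((+) (axis_site n) ` V) = {}"
proof -
  have "(+) (axis_site m) ` V \<inter> (+) (axis_site n) ` V = {}"
  proof (rule ccontr)
    assume "\<not> ?thesis"
    then obtain x y where xy: "x \<in> V" "y \<in> V" "axis_site m + x = axis_site n + y" by blast
    from fun_cong[OF xy(3), of 0] have "int m + x 0 = int n + y 0" by (simp add: axis_site_def)
    moreover have "\<bar>x 0\<bar> \<le> int R" "\<bar>y 0\<bar> \<le> int R"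
      using xy(1,2) assms by (auto simp: cube_def)
    ultimately show False using assms(3) by linarith
  qed
  then show ?thesis unfolding edges_def by blast
qed

context percolation
begin

text \<open>
  The mean times along the axis form a subadditive sequence, and this is the infimum that Fekete's
  lemma identifies with the limit of their averages. The range starts at \<open>1\<close> since the quotient at
  \<open>0\<close> is \<open>0\<close> by convention.
\<close>

definition speed :: "site set \<Rightarrow> site \<Rightarrow> real" where
  "speed V u = (INF n\<in>{1..}. enn2real (mean_time V u (axis_site n + u)) / real n)"

lemma speed_le:
  "n \<ge> 1 \<Longrightarrow> speed V u \<le> enn2real (mean_time V u (axis_site n + u)) / real n"
  unfolding speed_def by (intro cINF_lower bdd_belowI[of _ 0]) auto

lemma speed_ge:
  "(\<And>n. n \<ge> 1 \<Longrightarrow> c \<le> enn2real (mean_time V u (axis_site n + u)) / real n) \<Longrightarrow> c \<le> speed V u"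
  unfolding speed_def by (intro cINF_greatest) auto

text \<open>
  Whether a path exists does not depend on the weights, and without one the passage time is
  infinite everywhere.
\<close>

lemma passage_time_finite_of_mean:
  assumes "mean_time V u v < \<infinity>"
  shows "passage_time d V t u v < \<infinity>"
proof (cases "paths d V u v = {}")
  case True
  with assms show ?thesis by (simp add: mean_time_def passage_time_def M.emeasure_space_1)
next
  case False
  then show ?thesis using passage_time_finite by blast
qed

text \<open>
  The cube grows with \<open>n\<close> so that it contains the translates of the smaller cube in which the single
  steps from \<open>i\<close> to \<open>i + 1\<close> have finite mean.
\<close>

lemma mean_time_in_cube_finite:
  assumes V: "axis_invariant d V"
    and fin: "mean_time (V \<inter> cube d R) u (axis_site 1 + u) < \<infinity>"
  shows "n > 0 \<Longrightarrow> mean_time (V \<inter> cube d (R + n)) u (axis_site n + u) < \<infinity>"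
proof (induction n)
  case (Suc n)
  note VL = axis_invariantD(1)[OF V]
  let ?W = "V \<inter> cube d (R + Suc n)"
  have step: "mean_time ?W (axis_site n + u) (axis_site n + (axis_site 1 + u)) < \<infinity>"
  proof -
    have "(+) (axis_site n) ` (V \<inter> cube d R) \<subseteq> ?W"
      using cube_translate[OF dim_pos VL, of n R] cube_mono[of "R + n" "R + Suc n" d]
        axis_invariantD(2)[OF V, of n] by auto
    then have "mean_time ?W (axis_site n + u) (axis_site n + (axis_site 1 + u))
        \<le> mean_time ((+) (axis_site n) ` (V \<inter> cube d R)) (axis_site n + u) (axis_site n + (axis_site 1 + u))"
      by (rule mean_time_antimono)
    also have "\<dots> = mean_time (V \<inter> cube d R) u (axis_site 1 + u)"
      using VL by (intro mean_time_translate) auto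
    finally show ?thesis using fin by (rule le_less_trans)
  qed
  have eq: "axis_site (Suc n) + u = axis_site n + (axis_site 1 + u)"
    using axis_site_add[of n 1] by (simp add: add.assoc)
  show ?case
  proof (cases "n = 0")
    case True
    have "axis_site n + (axis_site 1 + u) = axis_site 1 + u" "axis_site n + u = u"
      unfolding True axis_site_0 by (rule add_0)+
    with step show ?thesis unfolding eq by metis
  next
    case False
    have "mean_time ?W u (axis_site n + u) \<le> mean_time (V \<inter> cube d (R + n)) u (axis_site n + u)"
      using cube_mono[of "R + n" "R + Suc n" d] by (intro mean_time_antimono) auto
    also have "\<dots> < \<infinity>" using False by (intro Suc.IH) simp
    finally have "mean_time ?W u (axis_site n + u)
        + mean_time ?W (axis_site n + u) (axis_site n + (axis_site 1 + u)) < \<infinity>"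
      using step by (simp add: ennreal_add_less_top)
    moreover have "mean_time ?W u (axis_site (Suc n) + u) \<le> mean_time ?W u (axis_site n + u)
        + mean_time ?W (axis_site n + u) (axis_site n + (axis_site 1 + u))"
      unfolding eq using VL by (intro mean_time_triangle) auto
    ultimately show ?thesis by (rule le_less_trans[rotated])
  qed
qed simp

text \<open>
  Monotone convergence for a decreasing sequence; finiteness of one mean is what makes it applicable.
\<close>

lemma mean_time_INF_cube:
  assumes "V \<subseteq> L" and fin: "mean_time (V \<inter> cube d R) u v < \<infinity>"
  shows "mean_time V u v = (INF R. mean_time (V \<inter> cube d R) u v)"
  unfolding mean_time_def passage_time_INF_cube[OF assms(1)]
proof (rule nn_integral_monotone_convergence_INF_decseq)
  show "decseq (\<lambda>R t. passage_time d (V \<inter> cube d R) t u v)"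
    
    by (intro decseq_SucI le_funI passage_time_antimono Int_mono order_refl cube_mono) simp
  show "(\<lambda>t. passage_time d (V \<inter> cube d R) t u v) \<in> borel_measurable M" for R
    using assms(1) by (intro passage_time_measurable_M) auto
  show "(\<integral>\<^sup>+t. passage_time d (V \<inter> cube d R) t u v \<partial>M) < \<infinity>"
    using fin by (simp add: mean_time_def)
qed

lemma mean_time_near_cube:
  assumes V: "V \<subseteq> L" and fin: "mean_time (V \<inter> cube d R0) u v < \<infinity>"
    and c: "mean_time V u v < c"
  obtains R where "R \<ge> R0" "mean_time (V \<inter> cube d R) u v < c"
proof -
  from c obtain R where R: "mean_time (V \<inter> cube d R) u v < c"
    unfolding mean_time_INF_cube[OF V fin] by (auto simp: INF_less_iff)
  have "mean_time (V \<inter> cube d (max R R0)) u v \<le> mean_time (V \<inter> cube d R) u v"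
    using cube_mono[of R "max R R0" d] by (intro mean_time_antimono) auto
  with R that[of "max R R0"] show ?thesis by auto
qed

text \<open>
  Every block is restricted to a translate of the same set \<open>B\<close>; for bounded \<open>B\<close> the summands then have
  finite range of dependence.
\<close>

lemma block_decomposition:
  assumes V: "axis_invariant d V" and B: "B \<subseteq> V" and u: "u \<in> V"
  shows "passage_time d V t u (axis_site (q * k) + u)
    \<le> (\<Sum>i<q. passage_time d ((+) (axis_site (i * k)) ` B) t
              (axis_site (i * k) + u) (axis_site (i * k) + (axis_site k + u)))"
proof (induction q)
  case 0
  have "[u] \<in> paths d V u u" using u by (simp add: paths_def)
  from passage_time_le_path[OF this] show ?case by simp
next
  case (Suc q)
  have eq: "axis_site (Suc q * k) + u = axis_site (q * k) + (axis_site k + u)"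
    using axis_site_add[of "q * k" k] by (simp add: add.assoc add.commute)
  have "(+) (axis_site (q * k)) ` B \<subseteq> V"
    using B axis_invariantD(3)[OF V] by blast
  then have "passage_time d V t (axis_site (q * k) + u) (axis_site (q * k) + (axis_site k + u))
      \<le> passage_time d ((+) (axis_site (q * k)) ` B) t
          (axis_site (q * k) + u) (axis_site (q * k) + (axis_site k + u))"
    by (rule passage_time_antimono)
  then show ?case
    unfolding eq sum.lessThan_Suc
    using order.trans[OF passage_time_triangle add_mono[OF Suc.IH]] by blast
qed

lemma mean_time_along_axis_finite:
  assumes V: "axis_invariant d V" and u: "u \<in> V"
    and fin: "mean_time (V \<inter> cube d R0) u (axis_site 1 + u) < \<infinity>"
  shows "mean_time V u (axis_site n + u) < \<infinity>"
proof (cases "n = 0")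
  case True
  have "[u] \<in> paths d V u u" using u by (simp add: paths_def)
  from passage_time_le_path[OF this] True show ?thesis by (simp add: mean_time_def)
next
  case False
  then have "mean_time (V \<inter> cube d (R0 + n)) u (axis_site n + u) < \<infinity>"
    using mean_time_in_cube_finite[OF V fin, of n] by simp
  moreover have "mean_time V u (axis_site n + u) \<le> mean_time (V \<inter> cube d (R0 + n)) u (axis_site n + u)"
    by (intro mean_time_antimono) auto
  ultimately show ?thesis by (rule le_less_trans[rotated])
qed

text \<open>
  An infimum over lengths and an infimum over cubes are approached simultaneously. The result is a
  block of bounded extent, translates of which can be placed elsewhere.
\<close>

lemma near_optimal_block:
  assumes V: "axis_invariant d V" and u: "u \<in> V"
    and fin: "mean_time (V \<inter> cube d R0) u (axis_site 1 + u) < \<infinity>"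
    and \<epsilon>: "0 < \<epsilon>"
  obtains k R where "k \<ge> 1" "R \<ge> R0"
    and "mean_time (V \<inter> cube d R) u (axis_site k + u) < ennreal (real k * (speed V u + \<epsilon>))"
proof -
  let ?a = "\<lambda>n. enn2real (mean_time V u (axis_site n + u))"
  have "\<exists>k\<in>{1..}. ?a k / real k < speed V u + \<epsilon>"
  proof (rule ccontr)
    assume "\<not> ?thesis"
    then have "speed V u + \<epsilon> \<le> speed V u" by (intro speed_ge) (auto simp: not_less)
    with \<epsilon> show False by simp
  qed
  then obtain k where k: "k \<ge> 1" "?a k / real k < speed V u + \<epsilon>" by auto
  then have ak: "?a k < real k * (speed V u + \<epsilon>)" by (simp add: field_simps)
  have c_pos: "0 < real k * (speed V u + \<epsilon>)"
    using ak by (rule le_less_trans[rotated]) simp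
  have "mean_time V u (axis_site k + u) < ennreal (real k * (speed V u + \<epsilon>))"
    using ak c_pos mean_time_along_axis_finite[OF V u fin, of k]
    by (metis ennreal_enn2real ennreal_less_iff enn2real_nonneg infinity_ennreal_def)
  then obtain R where "R \<ge> R0 + k"
    and "mean_time (V \<inter> cube d R) u (axis_site k + u) < ennreal (real k * (speed V u + \<epsilon>))"
    using mean_time_near_cube[OF axis_invariantD(1)[OF V] mean_time_in_cube_finite[OF V fin, of k]] k
    by auto
  with that[of k R] k show ?thesis by simp
qed

text \<open>
  The upper half of the law of large numbers comes from concatenating near-optimal blocks. The lower
  half needs no argument about single configurations: the mean of \<open>X n / n - \<mu>\<close> is non-negative, so
  its negative part has at most the mean of its positive part.
\<close>

theorem passage_time_converges_in_mean:
  assumes V: "axis_invariant d V" and u: "u \<in> V"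
    and fin: "mean_time (V \<inter> cube d R0) u (axis_site 1 + u) < \<infinity>"
  shows "tendsto_in_mean M
    (\<lambda>n t. enn2real (passage_time d V t u (axis_site n + u)) / real n) (speed V u)"
proof -
  note VL = axis_invariantD(1)[OF V]
  define a where "a n = enn2real (mean_time V u (axis_site n + u))" for n
  define X where "X n t = enn2real (passage_time d V t u (axis_site n + u))" for n t
  let ?\<mu> = "speed V u"
  note mean_fin = mean_time_along_axis_finite[OF V u fin]
  have T_fin: "passage_time d V t u (axis_site n + u) < \<infinity>" for n t
    using mean_fin by (rule passage_time_finite_of_mean)
  have X_int: "integrable M (X n)" and X_mean: "M.expectation (X n) = a n" for n
    unfolding X_def[abs_def] a_def mean_time_def
    using integral_enn2real[of "\<lambda>t. passage_time d V t u (axis_site n + u)" M]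
      T_fin mean_fin[of n] VL by (auto simp: mean_time_def)
  note [measurable] = borel_measurable_integrable[OF X_int]

  \<comment> \<open>One \<open>\<epsilon>\<close> each for the choice of the block, the weak law and the incomplete last block.\<close>
  have upper: "\<forall>\<^sub>F n in sequentially.
      M.expectation (\<lambda>t. max (X n t / real n - ?\<mu>) 0) \<le> 3 * \<epsilon>" if \<epsilon>: "\<epsilon> > 0" for \<epsilon>
  proof -
    obtain k R where k: "k \<ge> 1"
      and cheap: "mean_time (V \<inter> cube d R) u (axis_site k + u) < ennreal (real k * (?\<mu> + \<epsilon>))"
      using near_optimal_block[OF V u fin \<epsilon>] .
    have c_pos: "0 < real k * (?\<mu> + \<epsilon>)"
      using k \<epsilon> speed_ge[of 0 V u] by simp
    define B where "B = V \<inter> cube d R"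
    define z where "z i = axis_site (i * k)" for i
    define Z where "Z i t = enn2real (passage_time d ((+) (z i) ` B) t (z i + u) (z i + (axis_site k + u)))"
      for i t
    have BL: "B \<subseteq> L" and zL: "z i \<in> L" for i using VL by (auto simp: B_def z_def)
    have Z_mean_fin: "mean_time ((+) (z i) ` B) (z i + u) (z i + (axis_site k + u)) < \<infinity>" for i
      unfolding mean_time_translate[OF BL zL] using cheap[folded B_def] by (rule less_trans) simp
    have Z_fin: "passage_time d ((+) (z i) ` B) t (z i + u) (z i + (axis_site k + u)) < \<infinity>" for i t
      using Z_mean_fin by (rule passage_time_finite_of_mean)
    have Z_int: "integrable M (Z i)" for i
      unfolding Z_def[abs_def]
      using Z_fin Z_mean_fin[of i] translate_subset_lattice[OF BL zL]
      by (intro integral_enn2real) (auto simp: mean_time_def)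
    define b where "b = M.expectation (Z 0)"
    have b_le: "b \<le> real k * (?\<mu> + \<epsilon>)"
    proof -
      have "b = enn2real (mean_time ((+) (z 0) ` B) (z 0 + u) (z 0 + (axis_site k + u)))"
        unfolding b_def Z_def[abs_def] mean_time_def
        using Z_fin Z_mean_fin[of 0] translate_subset_lattice[OF BL zL]
        by (intro integral_enn2real) (auto simp: mean_time_def)
      then show ?thesis
        using cheap[folded B_def] c_pos unfolding mean_time_translate[OF BL zL]
        by (metis enn2real_leI less_imp_le)
    qed
    have ident: "distr M borel (Z i) = distr M borel (Z 0)" for i
      unfolding Z_def[abs_def]
      using distr_passage_time_translate[OF BL zL, of enn2real borel] by simp
    have indep: "M.indep_var borel (Z i) borel (Z j)" if "i + (2 * R + 1) \<le> j" for i j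
    proof -
      have "i * k + (2 * R + 1) * k \<le> j * k"
        using mult_le_mono1[OF that, of k] by (simp add: algebra_simps)
      moreover have "2 * R + 1 \<le> (2 * R + 1) * k" using mult_le_mono2[OF k, of "2 * R + 1"] by simp
      ultimately have "i * k + 2 * R < j * k" by linarith
      then show ?thesis
        unfolding Z_def[abs_def] using translate_subset_lattice[OF BL zL] unfolding z_def
        by (intro indep_passage_times edges_translates_disjoint[OF dim_pos]) (auto simp: B_def)
    qed
    define w where "w q = M.expectation (\<lambda>t. \<bar>(\<Sum>i<q. Z i t) - real q * b\<bar>) / real q" for q
    have "w \<longlonglongrightarrow> 0"
      unfolding w_def b_def
      by (rule M.weak_law_in_mean[where X = Z and r = "2 * R + 1"])
         (use Z_int ident indep in \<open>auto simp: Z_def[abs_def]\<close>)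
    moreover have "filterlim (\<lambda>n. n div k) sequentially sequentially"
      unfolding filterlim_at_top
    proof
      fix N
      show "\<forall>\<^sub>F n in sequentially. N \<le> n div k"
        using eventually_ge_at_top[of "N * k"]
        by eventually_elim (use k in \<open>simp add: less_eq_div_iff_mult_less_eq\<close>)
    qed
    ultimately have "(\<lambda>n. w (n div k)) \<longlonglongrightarrow> 0" by (rule filterlim_compose)
    then have "\<forall>\<^sub>F n in sequentially. w (n div k) < \<epsilon>"
      using \<epsilon> by (rule order_tendstoD)
    moreover
    \<comment> \<open>\<open>C\<close> bounds the mean time of an incomplete block uniformly in its length.\<close>
    define C where "C = (\<Sum>r<k. a r)"
    have "(\<lambda>n. C / real n) \<longlonglongrightarrow> 0" by (rule lim_const_over_n)
    then have "\<forall>\<^sub>F n in sequentially. C / real n < \<epsilon>"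
      using \<epsilon> by (rule order_tendstoD)
    ultimately show ?thesis
      using eventually_gt_at_top[of 0]
    proof eventually_elim
      case (elim n)
      define q where "q = n div k"
      \<comment> \<open>\<open>Y\<close> is the time of the last, incomplete block of \<open>n mod k\<close> steps.\<close>
      define Y where "Y t = enn2real (passage_time d V t (z q + u) (z q + (axis_site (n mod k) + u)))" for t
      have Y_fin: "passage_time d V t (z q + u) (z q + (axis_site (n mod k) + u)) < \<infinity>" for t
        using T_fin[of "\<lambda>e. t ((+) (z q) ` e)" "n mod k"]
          passage_time_translate[of d "z q" V t u "axis_site (n mod k) + u"]
          axis_invariantD(2)[OF V] by (simp add: z_def)
      have Y_mean: "mean_time V (z q + u) (z q + (axis_site (n mod k) + u)) = mean_time V u (axis_site (n mod k) + u)"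
        using mean_time_translate[OF VL zL[of q], of u "axis_site (n mod k) + u"]
          axis_invariantD(2)[OF V] by (simp add: z_def)
      have Y_int: "integrable M Y" and EY: "M.expectation Y = a (n mod k)"
        unfolding Y_def[abs_def] a_def Y_mean[symmetric]
        using integral_enn2real[of "\<lambda>t. passage_time d V t (z q + u) (z q + (axis_site (n mod k) + u))" M]
          Y_fin Y_mean mean_fin[of "n mod k"] VL by (auto simp: mean_time_def)
      have n_eq: "axis_site n + u = z q + (axis_site (n mod k) + u)"
        using axis_site_add[of "q * k" "n mod k"] by (simp add: q_def z_def add.assoc[symmetric])
      have sub: "X n t \<le> (\<Sum>i<q. Z i t) + Y t" for t
      proof -
        have blocks: "passage_time d V t u (z q + u) \<le> ennreal (\<Sum>i<q. Z i t)"
          using block_decomposition[OF V _ u, of B t q k] Z_fin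
          by (simp add: B_def z_def Z_def flip: sum_ennreal)
        have rest: "passage_time d V t (z q + u) (axis_site n + u) = ennreal (Y t)"
          using Y_fin by (simp add: Y_def n_eq)
        have "passage_time d V t u (axis_site n + u) \<le> ennreal (\<Sum>i<q. Z i t) + ennreal (Y t)"
          using passage_time_triangle add_mono[OF blocks eq_refl[OF rest]] by (rule order.trans)
        also have "\<dots> = ennreal ((\<Sum>i<q. Z i t) + Y t)"
          by (simp add: Y_def Z_def sum_nonneg)
        finally show ?thesis
          unfolding X_def by (rule enn2real_leI[rotated]) (simp add: Y_def Z_def sum_nonneg)
      qed
      have qk: "real q * real k \<le> real n"
        unfolding q_def of_nat_mult[symmetric] of_nat_le_iff by simp
      have qb: "real q * b \<le> real n * (?\<mu> + \<epsilon>)"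
      proof -
        have "real q * b \<le> real q * (real k * (?\<mu> + \<epsilon>))"
          using b_le by (intro mult_left_mono) auto
        also have "\<dots> \<le> real n * (?\<mu> + \<epsilon>)"
          using qk c_pos k by (simp add: mult.assoc[symmetric] zero_less_mult_iff)
        finally show ?thesis .
      qed
      have ptw: "max (X n t / real n - ?\<mu>) 0
          \<le> \<epsilon> + \<bar>(\<Sum>i<q. Z i t) - real q * b\<bar> / real n + Y t / real n" for t
      proof -
        have "X n t \<le> \<bar>(\<Sum>i<q. Z i t) - real q * b\<bar> + real n * (?\<mu> + \<epsilon>) + Y t"
          using sub[of t] qb by linarith
        then have "X n t / real n \<le> (\<bar>(\<Sum>i<q. Z i t) - real q * b\<bar> + real n * (?\<mu> + \<epsilon>) + Y t) / real n"
          by (rule divide_right_mono) simp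
        also have "\<dots> = \<bar>(\<Sum>i<q. Z i t) - real q * b\<bar> / real n + (?\<mu> + \<epsilon>) + Y t / real n"
          using elim by (simp add: add_divide_distrib)
        finally show ?thesis using \<epsilon> by (simp add: Y_def)
      qed
      have "M.expectation (\<lambda>t. max (X n t / real n - ?\<mu>) 0)
          \<le> M.expectation (\<lambda>t. \<epsilon> + \<bar>(\<Sum>i<q. Z i t) - real q * b\<bar> / real n + Y t / real n)"
        using X_int Z_int Y_int ptw by (intro integral_mono) auto
      also have "\<dots> = \<epsilon> + M.expectation (\<lambda>t. \<bar>(\<Sum>i<q. Z i t) - real q * b\<bar>) / real n + a (n mod k) / real n"
        using Z_int Y_int by (simp add: EY M.prob_space)
      also have "M.expectation (\<lambda>t. \<bar>(\<Sum>i<q. Z i t) - real q * b\<bar>) / real n \<le> w q"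
      proof (cases "q = 0")
        case False
        have "real q \<le> real n" by (simp add: q_def div_le_dividend)
        then show ?thesis
          unfolding w_def using False by (intro divide_left_mono integral_nonneg_AE) auto
      qed (simp add: w_def)
      also have "a (n mod k) \<le> C"
        unfolding C_def using k by (intro member_le_sum) (auto simp: a_def)
      finally show ?case using elim by (simp add: q_def divide_right_mono)
    qed
  qed

  have "(\<lambda>n. M.expectation (\<lambda>t. \<bar>X n t / real n - ?\<mu>\<bar>)) \<longlonglongrightarrow> 0"
  proof (rule tendsto_sandwich[of "\<lambda>_. 0" _ _ "\<lambda>n. 2 * M.expectation (\<lambda>t. max (X n t / real n - ?\<mu>) 0)"])
    show "\<forall>\<^sub>F n in sequentially. M.expectation (\<lambda>t. \<bar>X n t / real n - ?\<mu>\<bar>)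
        \<le> 2 * M.expectation (\<lambda>t. max (X n t / real n - ?\<mu>) 0)"
      using eventually_ge_at_top[of 1]
    proof eventually_elim
      case (elim n)
      \<comment> \<open>\<open>\<bar>y\<bar> = 2 max y 0 - y\<close>, and the mean of \<open>y\<close> is non-negative.\<close>
      have "M.expectation (\<lambda>t. \<bar>X n t / real n - ?\<mu>\<bar>)
          = M.expectation (\<lambda>t. 2 * max (X n t / real n - ?\<mu>) 0 - (X n t / real n - ?\<mu>))"
        by (intro Bochner_Integration.integral_cong refl) (auto simp: max_def)
      also have "\<dots> = 2 * M.expectation (\<lambda>t. max (X n t / real n - ?\<mu>) 0) - (a n / real n - ?\<mu>)"
        using X_int by (simp add: X_mean M.prob_space)
      also have "\<dots> \<le> 2 * M.expectation (\<lambda>t. max (X n t / real n - ?\<mu>) 0)"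
        using speed_le[OF elim, of V u] by (simp add: a_def)
      finally show ?case .
    qed
    show "(\<lambda>n. 2 * M.expectation (\<lambda>t. max (X n t / real n - ?\<mu>) 0)) \<longlonglongrightarrow> 0"
    proof (intro tendsto_mult_right_zero order_tendstoI)
      fix y :: real assume "y < 0"
      moreover have "0 \<le> M.expectation (\<lambda>t. max (X n t / real n - ?\<mu>) 0)" for n
        by (intro integral_nonneg_AE AE_I2) simp
      ultimately show "\<forall>\<^sub>F n in sequentially. y < M.expectation (\<lambda>t. max (X n t / real n - ?\<mu>) 0)"
        by (intro always_eventually allI) (rule less_le_trans)
    next
      fix y :: real assume "0 < y"
      then show "\<forall>\<^sub>F n in sequentially. M.expectation (\<lambda>t. max (X n t / real n - ?\<mu>) 0) < y"
        using upper[of "y / 4"] by (auto elim!: eventually_mono)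
    qed
  qed (auto intro!: always_eventually integral_nonneg_AE)
  then have "(\<lambda>n. ennreal (M.expectation (\<lambda>t. \<bar>X n t / real n - ?\<mu>\<bar>))) \<longlonglongrightarrow> ennreal 0"
    by (intro tendsto_ennrealI)
  moreover have "ennreal (M.expectation (\<lambda>t. \<bar>X n t / real n - ?\<mu>\<bar>)) = (\<integral>\<^sup>+t. ennreal \<bar>X n t / real n - ?\<mu>\<bar> \<partial>M)" for n
    using X_int by (intro nn_integral_eq_integral[symmetric]) auto
  ultimately show ?thesis
    by (simp add: tendsto_in_mean_def X_def)
qed

end

section \<open>Disjoint detours and the first moment\<close>

definition path_edges :: "site list \<Rightarrow> site set set" where
  "path_edges p = (\<lambda>(x, y). {x, y}) ` set (zip p (tl p))"

lemma path_edges_simps [simp]: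
  "path_edges [x] = {}" "path_edges (x # y # p) = insert {x, y} (path_edges (y # p))"
  by (simp_all add: path_edges_def)

lemma finite_path_edges [simp]: "finite (path_edges p)"
  by (simp add: path_edges_def)

lemma path_edges_subset:
  assumes "set p \<subseteq> V" "successively (neighbours d) p"
  shows "path_edges p \<subseteq> edges d V"
  using assms
proof (induction p rule: induct_list012)
  case (3 x y p)
  then have "{x, y} \<in> edges d V" by (intro edgesI) auto
  with 3 show ?case by simp
qed (auto simp: path_edges_def)

text \<open>
  The site with first coordinate \<open>a\<close> and \<open>i\<close>-th coordinate \<open>s\<close>, where \<open>i \<noteq> 0\<close>: all detours lie in
  coordinate planes through the axis.
\<close>

definition planar_site :: "nat \<Rightarrow> int \<Rightarrow> int \<Rightarrow> site" where
  "planar_site i a s = (\<lambda>j. if j = 0 then a else if j = i then s else 0)"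

lemma planar_site_neighbours:
  assumes "i \<in> {1..<d}"
  shows "neighbours d (planar_site i a s) (planar_site i a' s') \<longleftrightarrow> \<bar>a - a'\<bar> + \<bar>s - s'\<bar> = 1"
proof -
  have "(\<Sum>j<d. \<bar>planar_site i a s j - planar_site i a' s' j\<bar>)
      = (\<Sum>j\<in>{0, i}. \<bar>planar_site i a s j - planar_site i a' s' j\<bar>)"
    using assms by (intro sum.mono_neutral_right) (auto simp: planar_site_def)
  then show ?thesis using assms by (simp add: neighbours_def planar_site_def)
qed

lemma planar_site_origin: "planar_site i 0 0 = 0"
proof
  show "planar_site i 0 0 j = 0 j" for j by (simp add: planar_site_def)
qed

lemma planar_site_axis: "planar_site i 1 0 = axis_site 1"
proof
  show "planar_site i 1 0 j = axis_site 1 j" for j by (simp add: planar_site_def axis_site_def)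
qed

lemmas planar_site_ends = planar_site_origin planar_site_axis

lemma planar_site_in_cube:
  assumes "i \<in> {1..<d}" "\<bar>a\<bar> \<le> int R" "\<bar>s\<bar> \<le> int R"
  shows "planar_site i a s \<in> cube d R"
proof -
  have "planar_site i a s j = 0" if "d \<le> j" for j
    using assms(1) that by (simp add: planar_site_def)
  moreover have "\<bar>planar_site i a s j\<bar> \<le> int R" for j
    using assms(2,3) by (simp add: planar_site_def)
  ultimately show ?thesis by (simp add: cube_def lattice_sites_def)
qed

text \<open>
  There is one path for each of the \<open>2 d\<close> edges at the origin. Detour \<open>0\<close> is the edge from \<open>0\<close> to \<open>e\<^sub>1\<close>.
  Detours \<open>2 i\<close> and \<open>2 i + 1\<close> with \<open>i \<ge> 1\<close> leave in the positive and the negative direction of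
  coordinate \<open>i\<close> and then run parallel to that edge. Detour \<open>1\<close> leaves backwards along the axis and passes around
  detour \<open>2\<close> in the same plane, reaching \<open>e\<^sub>1\<close> from beyond.
\<close>

definition detour :: "nat \<Rightarrow> site list" where
  "detour k =
    (if k = 0 then [planar_site 1 0 0, planar_site 1 1 0]
     else if k = 1 then
       map (\<lambda>(a, s). planar_site 1 a s)
         [(0, 0), (- 1, 0), (- 1, 1), (- 1, 2), (0, 2), (1, 2), (2, 2), (2, 1), (2, 0), (1, 0)]
     else map (\<lambda>(a, s). planar_site (k div 2) a s)
       (let s = (if even k then 1 else - 1) in [(0, 0), (0, s), (1, s), (1, 0)]))"

lemma detour_length: "2 \<le> length (detour k)" "length (detour k) \<le> 10"
proof -
  show "2 \<le> length (detour k)"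
    by (simp add: detour_def Let_def)
  show "length (detour k) \<le> 10"
    by (simp add: detour_def Let_def)
qed

lemma detour_in_paths:
  assumes "2 \<le> d" "k < 2 * d"
  shows "detour k \<in> paths d (cube d 2) 0 (axis_site 1)"
proof -
  consider "k = 0" | "k = 1" | "2 \<le> k" "k div 2 \<in> {1..<d}" using assms by force
  then have "set (detour k) \<subseteq> cube d 2 \<and> successively (neighbours d) (detour k)"
    using assms(1)
    by cases (auto simp: detour_def Let_def planar_site_neighbours intro!: planar_site_in_cube)
  moreover have "hd (detour k) = 0" "last (detour k) = axis_site 1" "detour k \<noteq> []"
    by (auto simp: detour_def Let_def planar_site_ends[simplified])
  ultimately show ?thesis by (auto simp: paths_def)
qed

text \<open>
  The detours are told apart by their interior vertices: every vertex of detour \<open>k\<close> is labelled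
  \<open>0\<close> or \<open>k\<close>, and only the two common ends are labelled \<open>0\<close>.
\<close>

definition detour_label :: "nat \<Rightarrow> site \<Rightarrow> nat" where
  "detour_label d x =
    (if x 0 \<notin> {0, 1} then 1
     else \<Sum>i = 1..<d. if x i = 1 then 2 * i else if x i = - 1 then 2 * i + 1 else if x i = 2 then 1 else 0)"

lemma detour_label_planar_site:
  assumes "i \<in> {1..<d}"
  shows "detour_label d (planar_site i a s) =
    (if a \<notin> {0, 1} then 1 else if s = 1 then 2 * i else if s = - 1 then 2 * i + 1
     else if s = 2 then 1 else 0)"
proof -
  let ?f = "\<lambda>j (x :: int). if x = 1 then 2 * j else if x = - 1 then 2 * j + 1 else if x = 2 then 1 else 0"
  have "(\<Sum>j = 1..<d. ?f j (planar_site i a s j)) = (\<Sum>j\<in>{i}. ?f j (planar_site i a s j))"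
    using assms by (intro sum.mono_neutral_right) (auto simp: planar_site_def)
  then have "detour_label d (planar_site i a s)
      = (if planar_site i a s 0 \<notin> {0, 1} then 1 else ?f i (planar_site i a s i))"
    by (simp add: detour_label_def)
  with assms show ?thesis by (simp add: planar_site_def)
qed

lemma detour_label_edge:
  assumes "2 \<le> d" "k < 2 * d" "e \<in> path_edges (detour k)"
  shows "Max (detour_label d ` e) = k"
proof -
  consider "k = 0" | "k = 1" | "2 \<le> k" "k div 2 \<in> {1..<d}" "even k"
    | "2 \<le> k" "k div 2 \<in> {1..<d}" "odd k" using assms by force
  then show ?thesis
    using assms(1,3)
    by cases (auto simp: detour_def Let_def detour_label_planar_site)
qed

context percolation
begin

lemma mean_time_edge_finite_of_integrable:
  assumes "integrable P (\<lambda>x. x)"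
  shows "mean_time (cube d 2) 0 (axis_site 1) < \<infinity>"
proof -
  define e where "e = {0 :: site, axis_site 1}"
  have eq: "detour 0 = [0, axis_site 1]"
    unfolding detour_def by (simp only: if_True refl planar_site_ends)
  have p: "[0, axis_site 1] \<in> paths d (cube d 2) 0 (axis_site 1)"
    unfolding eq[symmetric] by (rule detour_in_paths[OF dim]) simp
  then have e: "e \<in> edges d L"
    unfolding e_def by (intro edgesI) (auto simp: paths_def cube_def)
  have proj: "(\<lambda>t. t e) \<in> measurable M P"
    unfolding weights_def using e by (rule measurable_component_singleton)
  have meas: "ennreal \<in> borel_measurable P"
    unfolding measurable_cong_sets[OF sets_P refl] by measurable
  have "mean_time (cube d 2) 0 (axis_site 1) \<le> (\<integral>\<^sup>+t. ennreal (t e) \<partial>M)"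
    unfolding mean_time_def using passage_time_le_path[OF p]
    by (intro nn_integral_mono) (simp add: e_def)
  also have "\<dots> = (\<integral>\<^sup>+x. ennreal x \<partial>distr M P (\<lambda>t. t e))"
    using nn_integral_distr[OF proj, of ennreal] meas by simp
  also have "distr M P (\<lambda>t. t e) = P"
    unfolding weights_def using e P.prob_space_axioms by (intro distr_PiM_component) auto
  also have "(\<integral>\<^sup>+x. ennreal x \<partial>P) \<le> (\<integral>\<^sup>+x. ennreal (norm x) \<partial>P)"
    by (intro nn_integral_mono ennreal_leI) simp
  also have "\<dots> < \<infinity>"
    using assms unfolding integrable_iff_bounded by blast
  finally show ?thesis .
qed

text \<open>
  A minimum of maxima is a maximum of minima: selecting the slowest edge \<open>\<phi> k\<close> on each of the
  \<open>2 d\<close> disjoint detours bounds the passage time by a constant times \<open>MIN k. t (\<phi> k)\<close>. The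
  selected edges are distinct, so this minimum has the law of the minimum of \<open>2 d\<close> independent
  weights. Summing over the finitely many selections removes the dependence of \<open>\<phi>\<close> on the weights.
\<close>

lemma mean_time_edge_finite_of_min_integrable:
  assumes "min_integrable P (2 * d)"
  shows "mean_time (cube d 2) 0 (axis_site 1) < \<infinity>"
proof -
  define I where "I = {..<2 * d}"
  define \<Phi> where "\<Phi> = (\<Pi>\<^sub>E k\<in>I. path_edges (detour k))"
  have "0 \<in> I" using dim by (simp add: I_def)
  then have I: "finite I" "I \<noteq> {}" by (simp add: I_def, blast)
  have fin_\<Phi>: "finite \<Phi>"
    unfolding \<Phi>_def using I by (intro finite_PiE) auto
  have edges: "path_edges (detour k) \<subseteq> edges d L" if "k \<in> I" for k
    using detour_in_paths[OF dim, of k] that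
    by (intro path_edges_subset) (auto simp: paths_def cube_def I_def)
  have \<Phi>_edges: "\<phi> k \<in> edges d L" if "\<phi> \<in> \<Phi>" "k \<in> I" for \<phi> k
    using that edges[of k] by (auto simp: \<Phi>_def PiE_def Pi_def)
  have inj: "inj_on \<phi> I" if "\<phi> \<in> \<Phi>" for \<phi>
  proof (rule inj_onI)
    fix j k assume jk: "j \<in> I" "k \<in> I" "\<phi> j = \<phi> k"
    have "Max (detour_label d ` \<phi> i) = i" if "i \<in> I" for i
      using that \<open>\<phi> \<in> \<Phi>\<close> by (intro detour_label_edge[OF dim]) (auto simp: I_def \<Phi>_def)
    with jk show "j = k" by metis
  qed
  have bound: "passage_time d (cube d 2) t 0 (axis_site 1)
      \<le> (\<Sum>\<phi>\<in>\<Phi>. 10 * ennreal (MIN k\<in>I. t (\<phi> k)))" for t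
  proof -
    have "\<exists>e. e \<in> path_edges (detour k) \<and> path_time t (detour k) \<le> 10 * ennreal (t e)" for k
    proof -
      obtain e where e: "e \<in> path_edges (detour k)"
        and le: "path_time t (detour k) \<le> of_nat (length (detour k)) * ennreal (t e)"
        using path_time_le_length_times_edge[OF detour_length(1)] unfolding path_edges_def by metis
      note le
      also have "of_nat (length (detour k)) * ennreal (t e) \<le> of_nat 10 * ennreal (t e)"
        using detour_length(2)[of k] by (intro mult_right_mono of_nat_mono) auto
      finally show ?thesis using e by auto
    qed
    then obtain \<psi> where \<psi>: "\<psi> k \<in> path_edges (detour k)"
      "path_time t (detour k) \<le> 10 * ennreal (t (\<psi> k))" for k
      by metis
    define \<phi> where "\<phi> = restrict \<psi> I"
    have \<phi>: "\<phi> \<in> \<Phi>" using \<psi>(1) by (auto simp: \<phi>_def \<Phi>_def)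
    have "(MIN k\<in>I. t (\<phi> k)) \<in> (\<lambda>k. t (\<phi> k)) ` I"
      using I by (intro Min_in) auto
    then obtain k where k: "k \<in> I" "(MIN k\<in>I. t (\<phi> k)) = t (\<phi> k)" by auto
    have "passage_time d (cube d 2) t 0 (axis_site 1) \<le> path_time t (detour k)"
      using k(1) by (intro passage_time_le_path detour_in_paths dim) (auto simp: I_def)
    also have "\<dots> \<le> 10 * ennreal (MIN k\<in>I. t (\<phi> k))"
      unfolding k(2) using \<psi>(2)[of k] k(1) by (simp add: \<phi>_def)
    also have "\<dots> \<le> (\<Sum>\<phi>\<in>\<Phi>. 10 * ennreal (MIN k\<in>I. t (\<phi> k)))"
      using fin_\<Phi> \<phi> by (intro member_le_sum) auto
    finally show ?thesis .
  qed
  define Q where "Q = (\<Pi>\<^sub>M i\<in>I. P)"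
  have min_int: "integrable Q (\<lambda>\<omega>. MIN i\<in>I. \<omega> i)"
    using assms by (simp add: min_integrable_def I_def Q_def)
  have min_meas: "(\<lambda>\<omega>. ennreal (MIN i\<in>I. \<omega> i)) \<in> borel_measurable Q"
    using borel_measurable_integrable[OF min_int] by measurable
  have select: "(\<lambda>t. \<lambda>k\<in>I. t (\<phi> k)) \<in> measurable M Q" if "\<phi> \<in> \<Phi>" for \<phi>
    unfolding Q_def weights_def
    by (rule measurable_restrict) (rule measurable_component_singleton[OF \<Phi>_edges[OF that]])
  have restr: "(MIN k\<in>I. t (\<phi> k)) = (MIN k\<in>I. (\<lambda>k\<in>I. t (\<phi> k)) k)" for t and \<phi> :: "nat \<Rightarrow> site set"
    by (intro arg_cong[where f = Min] image_cong) auto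
  have meas: "(\<lambda>t. MIN k\<in>I. t (\<phi> k)) \<in> borel_measurable M" if "\<phi> \<in> \<Phi>" for \<phi>
    using measurable_compose[OF select[OF that] borel_measurable_integrable[OF min_int]]
    by (subst restr) simp
  have same_law: "(\<integral>\<^sup>+t. ennreal (MIN k\<in>I. t (\<phi> k)) \<partial>M) = (\<integral>\<^sup>+\<omega>. ennreal (MIN k\<in>I. \<omega> k) \<partial>Q)"
    if "\<phi> \<in> \<Phi>" for \<phi>
  proof -
    have "(\<integral>\<^sup>+\<omega>. ennreal (MIN k\<in>I. \<omega> k) \<partial>Q)
        = (\<integral>\<^sup>+\<omega>. ennreal (MIN k\<in>I. \<omega> k) \<partial>distr M Q (\<lambda>t. \<lambda>k\<in>I. t (\<phi> k)))"
      using distr_PiM_reindex[of "edges d L" "\<lambda>_. P" \<phi> I, OF P.prob_space_axioms inj[OF that]]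
        \<Phi>_edges[OF that] by (simp add: weights_def Q_def Pi_def)
    also have "\<dots> = (\<integral>\<^sup>+t. ennreal (MIN k\<in>I. (\<lambda>k\<in>I. t (\<phi> k)) k) \<partial>M)"
      using select[OF that] min_meas by (intro nn_integral_distr) simp_all
    finally show ?thesis by (simp only: restr[symmetric])
  qed
  have "(\<integral>\<^sup>+\<omega>. ennreal (MIN k\<in>I. \<omega> k) \<partial>Q) \<le> (\<integral>\<^sup>+\<omega>. ennreal (norm (MIN k\<in>I. \<omega> k)) \<partial>Q)"
    by (intro nn_integral_mono ennreal_leI) simp
  also have "\<dots> < \<infinity>"
    using min_int unfolding integrable_iff_bounded by blast
  finally have fin: "(\<integral>\<^sup>+\<omega>. ennreal (MIN k\<in>I. \<omega> k) \<partial>Q) < \<infinity>" .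
  have "mean_time (cube d 2) 0 (axis_site 1)
      \<le> (\<integral>\<^sup>+t. (\<Sum>\<phi>\<in>\<Phi>. 10 * ennreal (MIN k\<in>I. t (\<phi> k))) \<partial>M)"
    unfolding mean_time_def by (intro nn_integral_mono bound)
  also have "\<dots> = (\<Sum>\<phi>\<in>\<Phi>. 10 * (\<integral>\<^sup>+t. ennreal (MIN k\<in>I. t (\<phi> k)) \<partial>M))"
    using meas by (simp add: nn_integral_sum nn_integral_cmult)
  also have "\<dots> = (\<Sum>\<phi>\<in>\<Phi>. 10 * (\<integral>\<^sup>+\<omega>. ennreal (MIN k\<in>I. \<omega> k) \<partial>Q))"
    by (intro sum.cong refl) (simp add: same_law)
  also have "\<dots> < \<infinity>"
    using fin by (simp add: ennreal_mult_less_top of_nat_less_top)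
  finally show ?thesis .
qed

end

section \<open>Convergence in probability\<close>

context prob_space
begin

lemma tendsto_in_probability_unique:
  assumes meas: "\<And>n. X n \<in> borel_measurable M"
    and c: "tendsto_in_probability M X c" and c': "tendsto_in_probability M X c'"
  shows "c = c'"
proof (rule ccontr)
  note [measurable] = meas
  assume "c \<noteq> c'"
  define \<epsilon> where "\<epsilon> = \<bar>c - c'\<bar> / 3"
  have \<epsilon>: "\<epsilon> > 0" using \<open>c \<noteq> c'\<close> by (simp add: \<epsilon>_def)
  have dist: "\<bar>c - c'\<bar> = 3 * \<epsilon>" by (simp add: \<epsilon>_def)
  let ?A = "\<lambda>c n. {\<omega> \<in> space M. \<bar>X n \<omega> - c\<bar> > \<epsilon>}"
  have "1 \<le> measure M (?A c n) + measure M (?A c' n)" for n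
  proof -
    have "\<bar>X n \<omega> - c\<bar> > \<epsilon>" if "\<not> \<bar>X n \<omega> - c'\<bar> > \<epsilon>" for \<omega>
      using that \<epsilon> dist by (smt (verit))
    then have "space M \<subseteq> ?A c n \<union> ?A c' n" by blast
    then have "measure M (space M) \<le> measure M (?A c n \<union> ?A c' n)"
      by (intro finite_measure_mono) measurable
    also have "\<dots> \<le> measure M (?A c n) + measure M (?A c' n)"
      by (intro measure_Un_le) measurable
    finally show ?thesis by (simp add: prob_space)
  qed
  moreover have "(\<lambda>n. measure M (?A c n) + measure M (?A c' n)) \<longlonglongrightarrow> 0 + 0"
    using c c' \<epsilon> by (intro tendsto_add) (auto simp: tendsto_in_probability_def)
  ultimately have "(1::real) \<le> 0 + 0"
    by (intro LIMSEQ_le_const[where X = "\<lambda>n. measure M (?A c n) + measure M (?A c' n)"]) auto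
  then show False by simp
qed

text \<open>
  This is Markov's inequality.
\<close>

lemma tendsto_in_mean_imp_in_probability:
  assumes meas: "\<And>n. X n \<in> borel_measurable M" and X: "tendsto_in_mean M X c"
  shows "tendsto_in_probability M X c"
  unfolding tendsto_in_probability_def
proof (intro allI impI)
  note [measurable] = meas
  fix \<epsilon> :: real assume \<epsilon>: "0 < \<epsilon>"
  let ?A = "\<lambda>n. {\<omega> \<in> space M. \<bar>X n \<omega> - c\<bar> > \<epsilon>}"
  have markov: "ennreal (measure M (?A n)) \<le> ennreal (1 / \<epsilon>) * (\<integral>\<^sup>+\<omega>. ennreal \<bar>X n \<omega> - c\<bar> \<partial>M)" for n
  proof -
    have "ennreal (measure M (?A n)) = (\<integral>\<^sup>+\<omega>. indicator (?A n) \<omega> \<partial>M)"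
      by (simp add: emeasure_eq_measure)
    also have "\<dots> \<le> (\<integral>\<^sup>+\<omega>. ennreal (1 / \<epsilon>) * ennreal \<bar>X n \<omega> - c\<bar> \<partial>M)"
    proof (rule nn_integral_mono)
      fix \<omega>
      have "1 \<le> 1 / \<epsilon> * \<bar>X n \<omega> - c\<bar>" if "\<omega> \<in> ?A n"
        using that \<epsilon> by (simp add: field_simps)
      then have "1 \<le> ennreal (1 / \<epsilon> * \<bar>X n \<omega> - c\<bar>)" if "\<omega> \<in> ?A n"
        using that by (metis ennreal_1 ennreal_leI)
      then show "indicator (?A n) \<omega> \<le> ennreal (1 / \<epsilon>) * ennreal \<bar>X n \<omega> - c\<bar>"
        using \<epsilon> by (auto simp: ennreal_mult[symmetric] indicator_def)
    qed
    also have "\<dots> = ennreal (1 / \<epsilon>) * (\<integral>\<^sup>+\<omega>. ennreal \<bar>X n \<omega> - c\<bar> \<partial>M)"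
      by (intro nn_integral_cmult) measurable
    finally show ?thesis .
  qed
  have "(\<lambda>n. ennreal (1 / \<epsilon>) * (\<integral>\<^sup>+\<omega>. ennreal \<bar>X n \<omega> - c\<bar> \<partial>M)) \<longlonglongrightarrow> ennreal (1 / \<epsilon>) * 0"
    using X unfolding tendsto_in_mean_def by (intro ennreal_tendsto_cmult) auto
  then have "(\<lambda>n. ennreal (measure M (?A n))) \<longlonglongrightarrow> 0"
    using markov
    by (intro tendsto_sandwich[of "\<lambda>_. 0" "\<lambda>n. ennreal (measure M (?A n))" sequentially
          "\<lambda>n. ennreal (1 / \<epsilon>) * (\<integral>\<^sup>+\<omega>. ennreal \<bar>X n \<omega> - c\<bar> \<partial>M)"]) auto
  then show "(\<lambda>n. measure M (?A n)) \<longlonglongrightarrow> 0"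
    by (simp add: ennreal_0[symmetric] del: ennreal_0)
qed

lemma tendsto_in_probability_perturb:
  assumes meas: "\<And>n. X n \<in> borel_measurable M" "\<And>n. E n \<in> borel_measurable M"
    and X: "tendsto_in_probability M X c" and E: "tendsto_in_probability M E 0"
    and near: "\<And>n \<omega>. \<bar>Y n \<omega> - X n \<omega>\<bar> \<le> E n \<omega>"
  shows "tendsto_in_probability M Y c"
  unfolding tendsto_in_probability_def
proof (intro allI impI)
  note [measurable] = meas
  fix \<epsilon> :: real assume \<epsilon>: "0 < \<epsilon>"
  let ?A = "\<lambda>n. {\<omega> \<in> space M. \<bar>X n \<omega> - c\<bar> > \<epsilon> / 2}"
  let ?B = "\<lambda>n. {\<omega> \<in> space M. \<bar>E n \<omega> - 0\<bar> > \<epsilon> / 2}"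
  let ?C = "\<lambda>n. {\<omega> \<in> space M. \<bar>Y n \<omega> - c\<bar> > \<epsilon>}"
  have bound: "measure M (?C n) \<le> measure M (?A n) + measure M (?B n)" for n
  proof -
    have "?C n \<subseteq> ?A n \<union> ?B n"
    proof
      fix \<omega> assume "\<omega> \<in> ?C n"
      then show "\<omega> \<in> ?A n \<union> ?B n"
        using near[of n \<omega>] by (auto simp: abs_if split: if_splits)
    qed
    then have "measure M (?C n) \<le> measure M (?A n \<union> ?B n)"
      by (intro finite_measure_mono) measurable
    also have "\<dots> \<le> measure M (?A n) + measure M (?B n)"
      by (intro measure_Un_le) measurable
    finally show ?thesis .
  qed
  have "(\<lambda>n. measure M (?A n) + measure M (?B n)) \<longlonglongrightarrow> 0 + 0"
  proof (intro tendsto_add)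
    show "(\<lambda>n. measure M (?A n)) \<longlonglongrightarrow> 0"
      by (rule X[unfolded tendsto_in_probability_def, rule_format]) (use \<epsilon> in simp)
    show "(\<lambda>n. measure M (?B n)) \<longlonglongrightarrow> 0"
      by (rule E[unfolded tendsto_in_probability_def, rule_format]) (use \<epsilon> in simp)
  qed
  then show "(\<lambda>n. measure M (?C n)) \<longlonglongrightarrow> 0"
    using bound
    by (intro tendsto_sandwich[of "\<lambda>_. 0" "\<lambda>n. measure M (?C n)" sequentially
          "\<lambda>n. measure M (?A n) + measure M (?B n)" 0]) auto
qed

lemma tendsto_in_probability_add_0:
  assumes meas: "\<And>n. X n \<in> borel_measurable M" "\<And>n. Y n \<in> borel_measurable M"
    and X: "tendsto_in_probability M X 0" and Y: "tendsto_in_probability M Y 0"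
    and nonneg: "\<And>n \<omega>. 0 \<le> Y n \<omega>"
  shows "tendsto_in_probability M (\<lambda>n \<omega>. X n \<omega> + Y n \<omega>) 0"
  by (rule tendsto_in_probability_perturb[OF meas X Y]) (use nonneg in auto)

text \<open>A family with one common law is tight.\<close>

lemma identically_distributed_over_n:
  fixes f :: "nat \<Rightarrow> 'a \<Rightarrow> real"
  assumes meas: "\<And>n. f n \<in> borel_measurable M"
    and ident: "\<And>n. distr M borel (f n) = distr M borel (f 0)"
  shows "tendsto_in_probability M (\<lambda>n \<omega>. f n \<omega> / real n) 0"
  unfolding tendsto_in_probability_def
proof (intro allI impI)
  note [measurable] = meas
  fix \<epsilon> :: real assume \<epsilon>: "0 < \<epsilon>"
  let ?D = "\<lambda>n. {\<omega> \<in> space M. \<bar>f 0 \<omega>\<bar> > \<epsilon> * real n}"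
  have "measure M {\<omega> \<in> space M. \<bar>f n \<omega> / real n - 0\<bar> > \<epsilon>} = measure M (?D n)" if "n > 0" for n
  proof -
    have law: "measure M {\<omega> \<in> space M. \<bar>f k \<omega>\<bar> > \<epsilon> * real n}
        = measure (distr M borel (f k)) {x. \<bar>x\<bar> > \<epsilon> * real n}" for k
      by (subst measure_distr) (auto intro!: arg_cong[where f = "measure M"])
    have "{\<omega> \<in> space M. \<bar>f n \<omega> / real n - 0\<bar> > \<epsilon>} = {\<omega> \<in> space M. \<bar>f n \<omega>\<bar> > \<epsilon> * real n}"
      using that by (auto simp: field_simps)
    then show ?thesis using law[of n] law[of 0] ident[of n] by simp
  qed
  then have "\<forall>\<^sub>F n in sequentially.
      measure M (?D n) = measure M {\<omega> \<in> space M. \<bar>f n \<omega> / real n - 0\<bar> > \<epsilon>}"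
    by (intro eventually_mono[OF eventually_gt_at_top[of 0]]) simp
  moreover have "(\<lambda>n. measure M (?D n)) \<longlonglongrightarrow> measure M (\<Inter>n. ?D n)"
  proof (rule finite_Lim_measure_decseq)
    show "range ?D \<subseteq> sets M" by auto
    show "decseq ?D"
    proof (rule decseq_SucI)
      show "?D (Suc n) \<subseteq> ?D n" for n
        using \<epsilon> by (auto simp: algebra_simps)
    qed
  qed
  moreover have "(\<Inter>n. ?D n) = {}"
  proof -
    have "\<exists>n. \<bar>f 0 \<omega>\<bar> \<le> \<epsilon> * real n" for \<omega>
    proof -
      obtain n where "\<bar>f 0 \<omega>\<bar> / \<epsilon> < real n" using reals_Archimedean2 by blast
      then show ?thesis using \<epsilon> by (intro exI[of _ n]) (simp add: field_simps)
    qed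
    then show ?thesis by (auto simp: not_less[symmetric])
  qed
  ultimately show "(\<lambda>n. measure M {\<omega> \<in> space M. \<bar>f n \<omega> / real n - 0\<bar> > \<epsilon>}) \<longlonglongrightarrow> 0"
    by (auto dest: Lim_transform_eventually)
qed

end

section \<open>Tubes\<close>

lemma axis_invariant_lattice_sites:
  assumes "0 < d" shows "axis_invariant d (lattice_sites d)"
  unfolding axis_invariant_def
proof (intro conjI allI order_refl equalityI)
  show "(+) (axis_site n) ` lattice_sites d \<subseteq> lattice_sites d" for n
    using assms by auto
  show "lattice_sites d \<subseteq> (+) (axis_site n) ` lattice_sites d" for n
  proof
    fix x assume x: "x \<in> lattice_sites d"
    have "x - axis_site n \<in> lattice_sites d"
      using x assms by (simp add: lattice_sites_def axis_site_def)
    then have "axis_site n + (x - axis_site n) \<in> (+) (axis_site n) ` lattice_sites d" by (rule imageI)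
    then show "x \<in> (+) (axis_site n) ` lattice_sites d" by simp
  qed
qed

lemma axis_invariant_tube_sites:
  assumes "0 < d" shows "axis_invariant d (tube_sites d K)"
  unfolding axis_invariant_def
proof (intro conjI allI equalityI)
  show "tube_sites d K \<subseteq> lattice_sites d" by (auto simp: tube_sites_def)
  show "(+) (axis_site n) ` tube_sites d K \<subseteq> tube_sites d K" for n
    using assms by (auto simp: tube_sites_def) (simp_all add: axis_site_def)
  show "tube_sites d K \<subseteq> (+) (axis_site n) ` tube_sites d K" for n
  proof
    fix x assume x: "x \<in> tube_sites d K"
    have "x - axis_site n \<in> tube_sites d K"
      using x assms by (simp add: tube_sites_def lattice_sites_def axis_site_def)
    then have "axis_site n + (x - axis_site n) \<in> (+) (axis_site n) ` tube_sites d K" by (rule imageI)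
    then show "x \<in> (+) (axis_site n) ` tube_sites d K" by simp
  qed
qed

definition interior_site :: "nat \<Rightarrow> nat \<Rightarrow> site" where
  "interior_site d m = (\<lambda>i. if i \<in> {1..<d} then int m else 0)"

lemma interior_site_in_lattice: "interior_site d m \<in> lattice_sites d"
  by (simp add: lattice_sites_def interior_site_def)

lemma interior_site_in_tube: "m < K \<Longrightarrow> interior_site d m \<in> tube_sites d K"
  by (simp add: tube_sites_def interior_site_in_lattice) (simp add: interior_site_def)

text \<open>
  Placing a cube in the middle of the cross-section turns an estimate in a cube of the lattice into
  one in the tube.
\<close>

lemma cube_around_interior_site:
  assumes "R \<le> m" "m + R < K"
  shows "(+) (interior_site d m) ` cube d R \<subseteq> tube_sites d K \<inter> cube d (m + R)"
proof
  fix y assume "y \<in> (+) (interior_site d m) ` cube d R"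
  then obtain x where x: "x \<in> cube d R" "y = interior_site d m + x" by blast
  have abs: "\<bar>x i\<bar> \<le> int R" if "i < d" for i using x(1) that by (simp add: cube_def)
  have y: "y i = (if i \<in> {1..<d} then int m else 0) + x i" for i
    using x(2) by (simp add: interior_site_def)
  have "y \<in> lattice_sites d"
    using x(1) unfolding x(2) by (simp add: cube_def interior_site_in_lattice)
  moreover have "0 \<le> y i \<and> y i < int K" if "i \<in> {1..<d}" for i
    using abs[of i] y[of i] that assms by auto
  moreover have "\<bar>y i\<bar> \<le> int (m + R)" if "i < d" for i
    using abs[OF that] y[of i] by auto
  ultimately show "y \<in> tube_sites d K \<inter> cube d (m + R)"
    by (auto simp: tube_sites_def cube_def)
qed

lemma neighbours_sym: "neighbours d x y \<Longrightarrow> neighbours d y x"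
  by (simp add: neighbours_def abs_minus_commute)

text \<open>Lowering one positive coordinate at a time leads from any point of the cross-section to the corner.\<close>

lemma tube_cross_section_connected:
  assumes "x \<in> tube_sites d K" "x 0 = 0"
  shows "paths d (tube_sites d K) 0 x \<noteq> {} \<and> paths d (tube_sites d K) x 0 \<noteq> {}"
  using assms
proof (induction "\<Sum>i<d. nat (x i)" arbitrary: x rule: less_induct)
  case less
  let ?V = "tube_sites d K"
  show ?case
  proof (cases "\<exists>i\<in>{1..<d}. x i \<noteq> 0")
    case False
    have "x = 0"
    proof
      show "x i = 0 i" for i
        using False less.prems by (cases "i < d"; cases "i = 0") (auto simp: tube_sites_def lattice_sites_def)
    qed
    with less.prems have "[0] \<in> paths d ?V 0 x" "[0] \<in> paths d ?V x 0"
      by (simp_all add: paths_def)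
    then show ?thesis by blast
  next
    case True
    then obtain i where i: "i \<in> {1..<d}" "x i \<noteq> 0" by blast
    then have pos: "x i > 0" and "x i < int K" using less.prems by (force simp: tube_sites_def)+
    define y where "y = x(i := x i - 1)"
    have "0 \<le> y j \<and> y j < int K" if "j \<in> {1..<d}" for j
    proof (cases "j = i")
      case True
      then show ?thesis using pos \<open>x i < int K\<close> by (simp add: y_def)
    next
      case False
      then show ?thesis using that less.prems(1) by (simp add: y_def tube_sites_def)
    qed
    then have y: "y \<in> ?V" "y 0 = 0"
      using less.prems i(1) by (simp_all add: tube_sites_def lattice_sites_def) (simp_all add: y_def)
    have "(\<Sum>j<d. nat (y j)) < (\<Sum>j<d. nat (x j))"
      using i pos by (intro sum_strict_mono_ex1) (auto simp: y_def)
    from less.hyps[OF this y] obtain p q where p: "p \<in> paths d ?V 0 y" and q: "q \<in> paths d ?V y 0"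
      by blast
    have "(\<Sum>j<d. \<bar>x j - y j\<bar>) = (\<Sum>j\<in>{i}. \<bar>x j - y j\<bar>)"
      using i by (intro sum.mono_neutral_right) (auto simp: y_def)
    then have xy: "neighbours d x y" by (simp add: neighbours_def y_def)
    then have "[x, y] \<in> paths d ?V x y" "[y, x] \<in> paths d ?V y x"
      using less.prems y(1) neighbours_sym[OF xy] by (simp_all add: paths_def)
    then show ?thesis using paths_join(1)[OF p] paths_join(1)[OF _ q] by blast
  qed
qed

context percolation
begin

text \<open>
  The detour from one base point to the other and back at both ends of the path costs an amount whose
  law does not depend on \<open>n\<close>. No moment of that cost is assumed, which is why the limit is
  transported in probability only.
\<close>

lemma tendsto_in_probability_change_base:
  assumes V: "axis_invariant d V"
    and uv: "paths d V u v \<noteq> {}" and vu: "paths d V v u \<noteq> {}"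
    and fin: "\<And>n t. passage_time d V t u (axis_site n + u) < \<infinity>"
    and lim: "tendsto_in_probability M
      (\<lambda>n t. enn2real (passage_time d V t u (axis_site n + u)) / real n) c"
  shows "tendsto_in_probability M
      (\<lambda>n t. enn2real (passage_time d V t v (axis_site n + v)) / real n) c"
proof -
  note VL = axis_invariantD(1)[OF V]
  note [measurable] = passage_time_measurable_M[OF VL]
  let ?T = "\<lambda>x y t. enn2real (passage_time d V t x y)"
  define D where "D x y n t = ?T (axis_site n + x) (axis_site n + y) t" for x y n t
  have link_fin: "passage_time d V t (axis_site n + x) (axis_site n + y) < \<infinity>"
    if ne: "paths d V x y \<noteq> {}" for x y n t
  proof -
    obtain p where "p \<in> paths d V x y" using ne by blast
    then have "map ((+) (axis_site n)) p \<in> paths d V (axis_site n + x) (axis_site n + y)"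
      using paths_translate[of d "axis_site n" V x y] axis_invariantD(2)[OF V, of n] by auto
    then show ?thesis by (rule passage_time_finite)
  qed
  have D_meas [measurable]: "D x y n \<in> borel_measurable M" for x y n
    unfolding D_def[abs_def] by measurable
  have ident: "distr M borel (D x y n) = distr M borel (D x y 0)" for x y n
    using distr_passage_time_translate[OF VL, of "axis_site n" enn2real borel x y]
      axis_invariantD(2)[OF V, of n] by (simp add: D_def[abs_def])
  have vanish: "tendsto_in_probability M (\<lambda>n t. D x y n t / real n) 0" for x y
    using M.identically_distributed_over_n[of "D x y"] D_meas ident by blast
  have vanish0: "tendsto_in_probability M (\<lambda>n t. D x y 0 t / real n) 0" for x y
    by (rule M.identically_distributed_over_n) simp_all
  have nonneg: "0 \<le> D x y n t / real m" for x y n m t by (simp add: D_def)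
  define E where "E n t = ((D u v 0 t / real n + D v u 0 t / real n) + D u v n t / real n) + D v u n t / real n"
    for n t
  have E_meas: "E n \<in> borel_measurable M" for n
    unfolding E_def[abs_def] by measurable
  have E_lim: "tendsto_in_probability M E 0"
    unfolding E_def[abs_def]
    by (intro M.tendsto_in_probability_add_0 vanish vanish0 nonneg) measurable
  have near: "\<bar>?T v (axis_site n + v) t / real n - ?T u (axis_site n + u) t / real n\<bar> \<le> E n t" for n t
  proof -
    have chain: "?T x y t \<le> ?T x x' t + ?T x' y' t + ?T y' y t"
      if f: "passage_time d V t x x' < \<infinity>" "passage_time d V t x' y' < \<infinity>" "passage_time d V t y' y < \<infinity>"
      for x y x' y'
    proof -
      have "passage_time d V t x y
          \<le> passage_time d V t x x' + (passage_time d V t x' y' + passage_time d V t y' y)"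
        using passage_time_triangle add_left_mono[OF passage_time_triangle] by (rule order.trans)
      also have "\<dots> = ennreal (?T x x' t + (?T x' y' t + ?T y' y t))"
        using f by simp
      finally show ?thesis
        by (subst add.assoc) (rule enn2real_leI[rotated], simp_all)
    qed
    have l: "passage_time d V t u v < \<infinity>" "passage_time d V t v u < \<infinity>"
      using link_fin[OF uv, of t 0] link_fin[OF vu, of t 0] by simp_all
    have v_fin: "passage_time d V t v (axis_site n + v) < \<infinity>"
    proof -
      have "passage_time d V t v (axis_site n + v) \<le> passage_time d V t v u
          + (passage_time d V t u (axis_site n + u) + passage_time d V t (axis_site n + u) (axis_site n + v))"
        using passage_time_triangle add_left_mono[OF passage_time_triangle] by (rule order.trans)
      also have "\<dots> < \<infinity>"
        using l(2) fin[of t n] link_fin[OF uv, of t n] by (simp add: ennreal_add_less_top)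
      finally show ?thesis .
    qed
    have "?T v (axis_site n + v) t \<le> ?T v u t + ?T u (axis_site n + u) t + D u v n t"
      unfolding D_def by (intro chain l fin link_fin uv)
    moreover have "?T u (axis_site n + u) t \<le> ?T u v t + ?T v (axis_site n + v) t + D v u n t"
      unfolding D_def by (intro chain l v_fin link_fin vu)
    moreover have "D u v 0 t = ?T u v t" "D v u 0 t = ?T v u t" by (simp_all add: D_def)
    moreover have "0 \<le> D x y k t" for x y k by (simp add: D_def)
    ultimately have "\<bar>?T v (axis_site n + v) t - ?T u (axis_site n + u) t\<bar>
        \<le> D u v 0 t + D v u 0 t + D u v n t + D v u n t"
      by (smt (verit))
    then have "\<bar>?T v (axis_site n + v) t - ?T u (axis_site n + u) t\<bar> / real n
        \<le> (D u v 0 t + D v u 0 t + D u v n t + D v u n t) / real n"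
      by (rule divide_right_mono) simp
    then show ?thesis
      by (simp add: E_def add_divide_distrib flip: diff_divide_distrib)
  qed
  show ?thesis
  proof (rule M.tendsto_in_probability_perturb[where E = E
        and X = "\<lambda>n t. ?T u (axis_site n + u) t / real n"])
    show "(\<lambda>t. ?T u (axis_site n + u) t / real n) \<in> borel_measurable M" for n
      by measurable
  qed (fact E_meas lim E_lim near)+
qed

lemma tube_time_constant_eqI:
  fixes K :: nat
  defines "V \<equiv> tube_sites d K"
  assumes lim: "tendsto_in_probability M
      (\<lambda>n t. enn2real (passage_time d V t 0 (axis_site n + 0)) / real n) c"
  shows "tube_time_constant P d K = c"
proof -
  have VL: "V \<subseteq> L" unfolding V_def by (auto simp: tube_sites_def)
  let ?W = "weights P d V" and ?r = "\<lambda>t. restrict t (edges d V)"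
  interpret W: prob_space ?W
    unfolding weights_def by (intro prob_space_PiM) unfold_locales
  have meas_W: "scaled_time d V n \<in> borel_measurable ?W" for n
    unfolding scaled_time_def[abs_def] weights_def
    using passage_time_measurable[OF VL order_refl] by measurable
  have r: "?r \<in> measurable M ?W"
    unfolding weights_def by (rule measurable_restrict_subset[OF edges_mono[OF VL]])
  have scaled: "scaled_time d V n (?r t) = enn2real (passage_time d V t 0 (axis_site n + 0)) / real n" for n t
    unfolding scaled_time_def axis_site_0 add_0_right
    by (rule arg_cong[where f = "\<lambda>x. enn2real x / real n"], rule passage_time_cong) simp
  have lim_W: "tendsto_in_probability ?W (scaled_time d V) c"
    unfolding tendsto_in_probability_def
  proof (intro allI impI)
    fix \<epsilon> :: real assume \<epsilon>: "0 < \<epsilon>"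
    have "measure ?W {\<omega> \<in> space ?W. \<bar>scaled_time d V n \<omega> - c\<bar> > \<epsilon>}
        = measure M {t \<in> space M. \<bar>enn2real (passage_time d V t 0 (axis_site n + 0)) / real n - c\<bar> > \<epsilon>}" for n
    proof -
      let ?A = "{\<omega> \<in> space ?W. \<bar>scaled_time d V n \<omega> - c\<bar> > \<epsilon>}"
      have "?A \<in> sets ?W" using meas_W[of n] by measurable
      then have "measure (distr M ?W ?r) ?A = measure M (?r -` ?A \<inter> space M)"
        using r by (intro measure_distr)
      also have "?r -` ?A \<inter> space M
          = {t \<in> space M. \<bar>enn2real (passage_time d V t 0 (axis_site n + 0)) / real n - c\<bar> > \<epsilon>}"
        using measurable_space[OF r] scaled[of n] by auto
      finally show ?thesis unfolding restrict_weights[OF VL] .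
    qed
    with lim \<epsilon> show "(\<lambda>n. measure ?W {\<omega> \<in> space ?W. \<bar>scaled_time d V n \<omega> - c\<bar> > \<epsilon>}) \<longlonglongrightarrow> 0"
      unfolding tendsto_in_probability_def by presburger
  qed
  show ?thesis
    unfolding tube_time_constant_def V_def[symmetric]
    by (rule the_equality, fact lim_W, rule W.tendsto_in_probability_unique[OF meas_W _ lim_W])
qed

text \<open>
  The limit in mean is unique because the limit in probability is.
\<close>

lemma lattice_time_constant_eq_speed:
  assumes fin: "mean_time (cube d 2) 0 (axis_site 1) < \<infinity>"
  shows "lattice_time_constant P d = speed L 0"
proof -
  have cube: "L \<inter> cube d 2 = cube d 2" by (auto simp: cube_def)
  have "tendsto_in_mean M
      (\<lambda>n t. enn2real (passage_time d L t 0 (axis_site n + 0)) / real n) (speed L 0)"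
  proof (rule passage_time_converges_in_mean)
    show "axis_invariant d L" by (rule axis_invariant_lattice_sites) simp
    show "0 \<in> L" by (simp add: lattice_sites_def)
    show "mean_time (L \<inter> cube d 2) 0 (axis_site 1 + 0) < \<infinity>"
      using fin unfolding cube add_0_right .
  qed
  then have lim: "tendsto_in_mean M (scaled_time d L) (speed L 0)"
    by (simp add: scaled_time_def[abs_def])
  have meas: "scaled_time d L n \<in> borel_measurable M" for n
    unfolding scaled_time_def[abs_def] using passage_time_measurable_M[OF order_refl] by measurable
  note in_prob = M.tendsto_in_mean_imp_in_probability[OF meas]
  show ?thesis
    unfolding lattice_time_constant_def
  proof (rule the_equality)
    show "tendsto_in_mean M (scaled_time d L) (speed L 0)" by (fact lim)
    show "c = speed L 0" if "tendsto_in_mean M (scaled_time d L) c" for c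
      using M.tendsto_in_probability_unique[OF meas in_prob[OF that] in_prob[OF lim]] .
  qed
qed

text \<open>
  All \<open>2 d\<close> detours around a site at distance at least \<open>2\<close> from the sides stay inside the tube.
\<close>

lemma mean_time_tube_edge_finite:
  assumes fin: "mean_time (cube d 2) 0 (axis_site 1) < \<infinity>" and m: "2 \<le> m" "m + 2 < K"
  shows "mean_time (tube_sites d K \<inter> cube d (m + 2)) (interior_site d m)
           (axis_site 1 + interior_site d m) < \<infinity>"
proof -
  have "mean_time (tube_sites d K \<inter> cube d (m + 2)) (interior_site d m + 0) (interior_site d m + axis_site 1)
      \<le> mean_time ((+) (interior_site d m) ` cube d 2) (interior_site d m + 0) (interior_site d m + axis_site 1)"
    using m by (intro mean_time_antimono cube_around_interior_site)
  also have "\<dots> = mean_time (cube d 2) 0 (axis_site 1)"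
    by (intro mean_time_translate interior_site_in_lattice) (auto simp: cube_def)
  finally show ?thesis using fin by (simp add: add.commute)
qed

text \<open>
  In particular the right-hand side is the same for all admissible interior sites, so that the site
  may be chosen to suit the cube that has to be placed around it.
\<close>

lemma tube_time_constant_eq_speed:
  assumes fin: "mean_time (cube d 2) 0 (axis_site 1) < \<infinity>" and m: "2 \<le> m" "m + 2 < K"
  shows "tube_time_constant P d K = speed (tube_sites d K) (interior_site d m)"
proof (rule tube_time_constant_eqI)
  let ?V = "tube_sites d K" and ?u = "interior_site d m"
  have V: "axis_invariant d ?V" by (rule axis_invariant_tube_sites) simp
  have u: "?u \<in> ?V" using m by (intro interior_site_in_tube) simp
  note edge = mean_time_tube_edge_finite[OF fin m]
  note [measurable] = passage_time_measurable_M[OF axis_invariantD(1)[OF V]]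
  have "paths d ?V 0 ?u \<noteq> {} \<and> paths d ?V ?u 0 \<noteq> {}"
    using u by (intro tube_cross_section_connected) (simp_all add: interior_site_def)
  then have ne: "paths d ?V ?u 0 \<noteq> {}" "paths d ?V 0 ?u \<noteq> {}" by simp_all
  have "tendsto_in_probability M
      (\<lambda>n t. enn2real (passage_time d ?V t ?u (axis_site n + ?u)) / real n) (speed ?V ?u)"
    by (rule M.tendsto_in_mean_imp_in_probability[OF _ passage_time_converges_in_mean[OF V u edge]]) measurable
  then show "tendsto_in_probability M
      (\<lambda>n t. enn2real (passage_time d ?V t 0 (axis_site n + 0)) / real n) (speed ?V ?u)"
    using passage_time_finite_of_mean[OF mean_time_along_axis_finite[OF V u edge]]
    by (intro tendsto_in_probability_change_base[OF V ne])
qed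

lemma mean_time_lattice_interior_site:
  "mean_time L (interior_site d m) (axis_site n + interior_site d m) = mean_time L 0 (axis_site n)"
proof -
  have translate: "(+) (interior_site d m) ` L = L"
  proof (intro equalityI subsetI)
    fix x assume x: "x \<in> L"
    then have "x - interior_site d m \<in> L"
      using interior_site_in_lattice[of d m] by (simp add: lattice_sites_def)
    then have "interior_site d m + (x - interior_site d m) \<in> (+) (interior_site d m) ` L" by (rule imageI)
    then show "x \<in> (+) (interior_site d m) ` L" by simp
  qed (auto intro: interior_site_in_lattice)
  have "mean_time ((+) (interior_site d m) ` L) (interior_site d m + 0) (interior_site d m + axis_site n)
      = mean_time L 0 (axis_site n)"
    by (intro mean_time_translate interior_site_in_lattice order_refl)
  then show ?thesis unfolding translate by (simp add: add.commute)
qed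

text \<open>
  For the lower bound any interior site will do. For the upper bound the cube of a near-optimal block
  of the lattice has some radius \<open>R\<close>, and the interior site at depth \<open>R\<close> makes it fit as soon as
  \<open>K \<ge> 2 R + 1\<close>.
\<close>

theorem tube_time_constant_tendsto:
  assumes fin: "mean_time (cube d 2) 0 (axis_site 1) < \<infinity>"
  shows "(\<lambda>K. tube_time_constant P d K) \<longlonglongrightarrow> lattice_time_constant P d"
proof -
  let ?\<mu> = "speed L 0"
  have cube: "L \<inter> cube d R = cube d R" for R by (auto simp: cube_def)
  have lower: "?\<mu> \<le> tube_time_constant P d K" if K: "K \<ge> 5" for K
  proof -
    let ?V = "tube_sites d K" and ?u = "interior_site d 2"
    have V: "axis_invariant d ?V" by (rule axis_invariant_tube_sites) simp
    have u: "?u \<in> ?V" using K by (intro interior_site_in_tube) simp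
    have edge: "mean_time (?V \<inter> cube d (2 + 2)) ?u (axis_site 1 + ?u) < \<infinity>"
      using K by (intro mean_time_tube_edge_finite[OF fin]) simp_all
    have "?\<mu> \<le> speed ?V ?u"
    proof (rule speed_ge)
      fix n :: nat assume n: "n \<ge> 1"
      have "mean_time L 0 (axis_site n) \<le> mean_time ?V ?u (axis_site n + ?u)"
        unfolding mean_time_lattice_interior_site[of 2, symmetric]
        by (rule mean_time_antimono[OF axis_invariantD(1)[OF V]])
      then have "enn2real (mean_time L 0 (axis_site n)) \<le> enn2real (mean_time ?V ?u (axis_site n + ?u))"
        using mean_time_along_axis_finite[OF V u edge, of n] by (intro enn2real_mono) simp_all
      then have "enn2real (mean_time L 0 (axis_site n)) / real n
          \<le> enn2real (mean_time ?V ?u (axis_site n + ?u)) / real n"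
        by (rule divide_right_mono) simp
      moreover have "?\<mu> \<le> enn2real (mean_time L 0 (axis_site n)) / real n"
        using speed_le[OF n, of L 0] by simp
      ultimately show "?\<mu> \<le> enn2real (mean_time ?V ?u (axis_site n + ?u)) / real n" by simp
    qed
    also have "\<dots> = tube_time_constant P d K"
      using K by (intro tube_time_constant_eq_speed[OF fin, symmetric]) simp_all
    finally show ?thesis .
  qed
  have upper: "\<forall>\<^sub>F K in sequentially. tube_time_constant P d K \<le> ?\<mu> + \<epsilon>" if \<epsilon>: "\<epsilon> > 0" for \<epsilon>
  proof -
    have fin_L: "mean_time (L \<inter> cube d 2) 0 (axis_site 1 + 0) < \<infinity>"
      using fin unfolding cube add_0_right .
    have "0 \<in> L" by (simp add: lattice_sites_def)
    from near_optimal_block[OF axis_invariant_lattice_sites[OF dim_pos] this fin_L \<epsilon>]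
    obtain k R where k: "k \<ge> 1" and R: "R \<ge> 2"
      and cheap: "mean_time (L \<inter> cube d R) 0 (axis_site k + 0) < ennreal (real k * (?\<mu> + \<epsilon>))"
      by blast
    have \<mu>_nonneg: "0 \<le> ?\<mu>" by (rule speed_ge) simp
    have "tube_time_constant P d K \<le> ?\<mu> + \<epsilon>" if K: "K \<ge> 2 * R + 1" for K
    proof -
      let ?V = "tube_sites d K" and ?u = "interior_site d R"
      have "mean_time ?V (?u + 0) (?u + axis_site k) \<le> mean_time ((+) ?u ` cube d R) (?u + 0) (?u + axis_site k)"
        using cube_around_interior_site[of R R K d] K by (intro mean_time_antimono) auto
      also have "\<dots> = mean_time (cube d R) 0 (axis_site k)"
        by (intro mean_time_translate interior_site_in_lattice) (auto simp: cube_def)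
      also have "\<dots> \<le> ennreal (real k * (?\<mu> + \<epsilon>))"
        using cheap unfolding cube add_0_right by (rule less_imp_le)
      finally have "enn2real (mean_time ?V (?u + 0) (?u + axis_site k)) \<le> real k * (?\<mu> + \<epsilon>)"
        using \<mu>_nonneg \<epsilon> by (intro enn2real_leI) simp_all
      then have "enn2real (mean_time ?V ?u (axis_site k + ?u)) / real k \<le> ?\<mu> + \<epsilon>"
        unfolding add_0_right add.commute[of ?u] using k by (simp add: field_simps)
      with speed_le[OF k, of ?V ?u] have "speed ?V ?u \<le> ?\<mu> + \<epsilon>" by linarith
      then show ?thesis
        using tube_time_constant_eq_speed[OF fin, of R K] R K by simp
    qed
    then show ?thesis by (rule eventually_sequentiallyI)
  qed
  show ?thesis
    unfolding lattice_time_constant_eq_speed[OF fin]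
  proof (rule order_tendstoI)
    fix y assume "y < ?\<mu>"
    then have "y < tube_time_constant P d K" if "K \<ge> 5" for K
      using lower[OF that] by simp
    then show "\<forall>\<^sub>F K in sequentially. y < tube_time_constant P d K"
      by (rule eventually_sequentiallyI)
  next
    fix y assume "?\<mu> < y"
    then have "\<forall>\<^sub>F K in sequentially. tube_time_constant P d K \<le> ?\<mu> + (y - ?\<mu>) / 2"
      by (intro upper) simp
    then show "\<forall>\<^sub>F K in sequentially. tube_time_constant P d K < y"
    proof eventually_elim
      case (elim K)
      with \<open>?\<mu> < y\<close> show ?case by (simp add: field_simps)
    qed
  qed
qed

end

theorem proposition5p2:
  fixes d :: nat and P :: "real measure"
  assumes "d \<ge> 2"
    and "prob_space P"
    and "sets P = sets borel"
    and "AE x in P. 0 \<le> x"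
    and "\<not> (\<exists>c. AE x in P. x = c)"
    and "integrable P (\<lambda>x. x) \<or> min_integrable P (2 * d)"
  shows "(\<lambda>K. tube_time_constant P d K) \<longlonglongrightarrow> lattice_time_constant P d"
proof -
  interpret prob_space P by fact
  interpret percolation P d
    by unfold_locales (use assms in auto)
  show ?thesis
    using assms(6) mean_time_edge_finite_of_integrable mean_time_edge_finite_of_min_integrable
    by (intro tube_time_constant_tendsto) blast
qed

end
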